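(* Let $f$ be a non-affine and diffused operator convex function. Let $\rho_{AB}$ and $\sigma_{AB}$ be strictly positive matrices on a composite system $AB$ (i.e. on $\mathcal{H}_A\otimes\mathcal{H}_B$), and let $\rho_A=\mathrm{Tr}_B(\rho_{AB})$ and $\sigma_A=\mathrm{Tr}_B(\sigma_{AB})$. Then equality in $$S_f(\rho_{AB}\,||\,\sigma_{AB})\ \geq\ S_f(\rho_A\,||\,\sigma_A)$$ holds if and only if $$\mathrm{Tr}\left(\sigma_{AB}^{\imath t}\,\rho_{AB}^{-\imath t+1}\right)=\mathrm{Tr}\left(\sigma_A^{\imath t}\,\rho_A^{-\imath t+1}\right)\qquad\text{for all } t\in\mathbb{C},$$ where $\imath=\sqrt{-1}$.
   Context: All Hilbert spaces are finite-dimensional and complex. "Strictly positive" means Hermitian positive definite; no trace normalization is assumed. For Hermitian $A$, $f(A)$ is defined by the spectral decomposition; for strictly positive $X$ and $z\in\mathbb{C}$, $X^z=\exp(z\ln X)$. A real function $f$ on an interval is operator convex if $f[\lambda A+(1-\lambda)B]\leq\lambda f(A)+(1-\lambda)f(B)$ for all Hermitian matrices $A,B$ (of the same, arbitrary size) with spectra in the domain of $f$ and all $0\le\lambda\le1$. Diffused: a non-affine operator convex function $f$ on $(t_0-a,t_0+a)$, $a>0$, is called diffused if it has the representation $$f(t)=b+ct+\kappa\int_{-a}^{a}\frac{(t-t_0)^2}{a^2-(t-t_0)x}\,p_X(x)\,dx$$ with $b,c\in\mathbb{R}$, $\kappa>0$ and $p_X$ a probability density function on $[-a,a]$ that is strictly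 positive almost everywhere on a (nondegenerate) subinterval of $[-a,a]$ having $x=0$ as an interior or boundary point. Quantum $f$-relative entropy: for strictly positive $\rho,\sigma$ on the same $d$-dimensional space, $$S_f(\rho||\sigma)=\mathrm{vec}(\sqrt{\rho})^\dagger f\left[\sigma\otimes(\rho^{-1})^{\mathsf T}\right]\mathrm{vec}(\sqrt{\rho})=\sum_{i,j=1}^d p_i f\left(\frac{q_j}{p_i}\right)|\langle i_\rho|j_\sigma\rangle|^2,$$ where $\rho=\sum_i p_i|i_\rho\rangle\langle i_\rho|$ and $\sigma=\sum_j q_j|j_\sigma\rangle\langle j_\sigma|$ are spectral decompositions and $\mathrm{vec}(A)$ stacks the entries of $A$ row by row. Standing convention: the domain of $f$ is an interval of positive reals (contained in $(0,\alpha)$ for some finite $\alpha$) which contains the eigenvalue ratios $q_j/p_i$ for every $S_f(\rho||\sigma)$ that occurs. *)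

theory Defs
  imports
    "HOL-Analysis.Analysis"
    "Jordan_Normal_Form.Spectral_Radius"
    "Jordan_Normal_Form.Schur_Decomposition"
    "Jordan_Normal_Form.Gauss_Jordan_Elimination"
begin

definition hermitian_mat :: "nat \<Rightarrow> complex mat \<Rightarrow> bool" where
  "hermitian_mat n A \<longleftrightarrow> A \<in> carrier_mat n n \<and> mat_adjoint A = A"

definition strictly_positive_mat :: "nat \<Rightarrow> complex mat \<Rightarrow> bool" where
  "strictly_positive_mat n A \<longleftrightarrow>
     hermitian_mat n A \<and> (\<forall>v \<in> carrier_vec n. v \<noteq> 0\<^sub>v n \<longrightarrow> Re ((A *\<^sub>v v) \<bullet>c v) > 0)"

definition mat_le :: "nat \<Rightarrow> complex mat \<Rightarrow> complex mat \<Rightarrow> bool" where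
  "mat_le n A B \<longleftrightarrow>
     hermitian_mat n (B - A) \<and> (\<forall>v \<in> carrier_vec n. Re (((B - A) *\<^sub>v v) \<bullet>c v) \<ge> 0)"

definition mat_trace :: "'a :: comm_monoid_add mat \<Rightarrow> 'a" where
  "mat_trace A = (\<Sum>i<dim_row A. A $$ (i, i))"

definition spectral_decomp :: "complex mat \<Rightarrow> complex mat \<Rightarrow> (nat \<Rightarrow> real) \<Rightarrow> bool" where
  "spectral_decomp A U d \<longleftrightarrow>
     (\<exists>n. A \<in> carrier_mat n n \<and> U \<in> carrier_mat n n \<and> mat_adjoint U * U = 1\<^sub>m n \<and>
          A = U * mat_diag n (\<lambda>i. complex_of_real (d i)) * mat_adjoint U)"

text \<open>
  The description below is only meaningful for Hermitian matrices; it does not depend on the choice of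
  the spectral decomposition by \<open>herm_fun_eq\<close>.
\<close>

definition herm_fun :: "(real \<Rightarrow> real) \<Rightarrow> complex mat \<Rightarrow> complex mat" where
  "herm_fun f A = (THE B. \<exists>U d. spectral_decomp A U d \<and>
     B = U * mat_diag (dim_row A) (\<lambda>i. complex_of_real (f (d i))) * mat_adjoint U)"

lemma mat_adjoint_carrier:
  "U \<in> carrier_mat m n \<Longrightarrow> mat_adjoint U \<in> carrier_mat n m"
  unfolding mat_adjoint_def by (auto simp: cols_def)

lemma herm_fun_unique:
  assumes 1: "spectral_decomp A U d" and 2: "spectral_decomp A V e"
  shows "U * mat_diag (dim_row A) (\<lambda>i. complex_of_real (f (d i))) * mat_adjoint U =
         V * mat_diag (dim_row A) (\<lambda>i. complex_of_real (f (e i))) * mat_adjoint V"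
proof -
  let ?c = "complex_of_real"
  from 1 obtain n where A: "A \<in> carrier_mat n n" and U: "U \<in> carrier_mat n n"
    and UU: "mat_adjoint U * U = 1\<^sub>m n"
    and AU: "A = U * mat_diag n (\<lambda>i. ?c (d i)) * mat_adjoint U"
    unfolding spectral_decomp_def by blast
  from 2 A have V: "V \<in> carrier_mat n n" and VV: "mat_adjoint V * V = 1\<^sub>m n"
    and AV: "A = V * mat_diag n (\<lambda>i. ?c (e i)) * mat_adjoint V"
    unfolding spectral_decomp_def by auto
  define U' where "U' = mat_adjoint U"
  define V' where "V' = mat_adjoint V"
  define D where "D = mat_diag n (\<lambda>i. ?c (d i))"
  define E where "E = mat_diag n (\<lambda>i. ?c (e i))"
  define F where "F = mat_diag n (\<lambda>i. ?c (f (d i)))"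
  define G where "G = mat_diag n (\<lambda>i. ?c (f (e i)))"
  have carr [simp]: "U \<in> carrier_mat n n" "V \<in> carrier_mat n n" "U' \<in> carrier_mat n n"
    "V' \<in> carrier_mat n n" "D \<in> carrier_mat n n" "E \<in> carrier_mat n n"
    "F \<in> carrier_mat n n" "G \<in> carrier_mat n n"
    using U V unfolding U'_def V'_def D_def E_def F_def G_def by (auto intro: mat_adjoint_carrier)
  have inv: "U' * U = 1\<^sub>m n" "V' * V = 1\<^sub>m n" "U * U' = 1\<^sub>m n" "V * V' = 1\<^sub>m n"
    using UU VV mat_mult_left_right_inverse[of U' n U] mat_mult_left_right_inverse[of V' n V]
    unfolding U'_def[symmetric] V'_def[symmetric] by auto
  have assoc: "(X * Y) * Z = X * (Y * Z)"
    if "X \<in> carrier_mat n n" "Y \<in> carrier_mat n n" "Z \<in> carrier_mat n n" for X Y Z :: "complex mat"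
    using that by (rule assoc_mult_mat)
  have mult [simp]: "X * Y \<in> carrier_mat n n"
    if "X \<in> carrier_mat n n" "Y \<in> carrier_mat n n" for X Y :: "complex mat"
    using that by (rule mult_carrier_mat)
  have one [simp]: "1\<^sub>m n * X = X" "X * 1\<^sub>m n = X" if "X \<in> carrier_mat n n" for X :: "complex mat"
    using that by auto
  have "V' * (U * D * U') * U = V' * (V * E * V') * U"
    using AU AV unfolding U'_def D_def V'_def E_def by simp
  also have "V' * (U * D * U') * U = V' * U * D * (U' * U)" by (simp add: assoc)
  also have "V' * (V * E * V') * U = (V' * V) * E * (V' * U)" by (simp add: assoc)
  finally have W: "(V' * U) * D = E * (V' * U)" by (simp add: inv)
  have WW: "V' * U \<in> carrier_mat n n" by simp
  have "(V' * U) * F = G * (V' * U)"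
  proof (rule eq_matI)
    fix i j assume "i < dim_row (G * (V' * U))" "j < dim_col (G * (V' * U))"
    then have ij: "i < n" "j < n" using U by (auto simp: G_def mat_diag_def)
    have "((V' * U) * D) $$ (i, j) = (E * (V' * U)) $$ (i, j)" using W by simp
    then have "(V' * U) $$ (i, j) * ?c (d j) = ?c (e i) * (V' * U) $$ (i, j)"
      unfolding D_def E_def mat_diag_mult_right[OF WW] mat_diag_mult_left[OF WW] using ij by simp
    then have "(V' * U) $$ (i, j) * ?c (f (d j)) = ?c (f (e i)) * (V' * U) $$ (i, j)"
      by (cases "(V' * U) $$ (i, j) = 0") auto
    then show "((V' * U) * F) $$ (i, j) = (G * (V' * U)) $$ (i, j)"
      unfolding F_def G_def mat_diag_mult_right[OF WW] mat_diag_mult_left[OF WW] using ij by simp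
  qed (use carrier_matD[OF U] carrier_matD[OF carr(4)] in \<open>auto simp: G_def F_def mat_diag_def\<close>)
  then have "V * ((V' * U) * F) * U' = V * (G * (V' * U)) * U'" by simp
  also have "V * ((V' * U) * F) * U' = (V * V') * U * F * U'" by (simp add: assoc)
  also have "V * (G * (V' * U)) * U' = V * G * V' * (U * U')" by (simp add: assoc)
  finally have "U * F * U' = V * G * V'" by (simp add: inv)
  then show ?thesis using A unfolding U'_def V'_def F_def G_def by auto
qed

lemma herm_fun_eq:
  assumes "spectral_decomp A U d"
  shows "herm_fun f A = U * mat_diag (dim_row A) (\<lambda>i. complex_of_real (f (d i))) * mat_adjoint U"
  unfolding herm_fun_def
  using assms herm_fun_unique by (intro the_equality) blast+

definition mat_exp :: "complex mat \<Rightarrow> complex mat" where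
  "mat_exp A = Matrix.mat (dim_row A) (dim_col A) (\<lambda>ij. \<Sum>k. (A ^\<^sub>m k) $$ ij / fact k)"

definition mat_cpow :: "complex mat \<Rightarrow> complex \<Rightarrow> complex mat" where
  "mat_cpow X z = mat_exp (z \<cdot>\<^sub>m herm_fun ln X)"

definition operator_convex_on :: "real set \<Rightarrow> (real \<Rightarrow> real) \<Rightarrow> bool" where
  "operator_convex_on I f \<longleftrightarrow>
     (\<forall>n A B. \<forall>l \<in> {0..1::real}.
        hermitian_mat n A \<longrightarrow> hermitian_mat n B \<longrightarrow>
        spectrum A \<subseteq> complex_of_real ` I \<longrightarrow> spectrum B \<subseteq> complex_of_real ` I \<longrightarrow>
        mat_le n
          (herm_fun f (complex_of_real l \<cdot>\<^sub>m A + complex_of_real (1 - l) \<cdot>\<^sub>m B))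
          (complex_of_real l \<cdot>\<^sub>m herm_fun f A + complex_of_real (1 - l) \<cdot>\<^sub>m herm_fun f B))"

definition affine_fun_on :: "real set \<Rightarrow> (real \<Rightarrow> real) \<Rightarrow> bool" where
  "affine_fun_on I f \<longleftrightarrow> (\<exists>b c. \<forall>t \<in> I. f t = b + c * t)"

definition pdf_on :: "real set \<Rightarrow> (real \<Rightarrow> real) \<Rightarrow> bool" where
  "pdf_on S p \<longleftrightarrow> (\<forall>x \<in> S. p x \<ge> 0) \<and> set_integrable lborel S p \<and> (LINT x:S|lborel. p x) = 1"

definition diffused :: "real \<Rightarrow> real \<Rightarrow> (real \<Rightarrow> real) \<Rightarrow> bool" where
  "diffused t0 a f \<longleftrightarrow>
     a > 0 \<and>
     operator_convex_on {t0 - a<..<t0 + a} f \<and>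
     \<not> affine_fun_on {t0 - a<..<t0 + a} f \<and>
     (\<exists>b c \<kappa> p. \<kappa> > 0 \<and> pdf_on {-a..a} p \<and>
        (\<exists>l u. -a \<le> l \<and> l < u \<and> u \<le> a \<and> 0 \<in> {l..u} \<and>
               (AE x in lborel. x \<in> {l..u} \<longrightarrow> p x > 0)) \<and>
        (\<forall>t \<in> {t0 - a<..<t0 + a}.
           f t = b + c * t +
             \<kappa> * (LINT x:{-a..a}|lborel. (t - t0)\<^sup>2 / (a\<^sup>2 - (t - t0) * x) * p x)))"

text \<open>Row-by-row vectorization, with the matching (row-major) Kronecker product.\<close>

definition vec_of_mat :: "'a mat \<Rightarrow> 'a Matrix.vec" where
  "vec_of_mat A = Matrix.vec (dim_row A * dim_col A) (\<lambda>i. A $$ (i div dim_col A, i mod dim_col A))"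

definition kron :: "'a :: times mat \<Rightarrow> 'a mat \<Rightarrow> 'a mat" where
  "kron A B = Matrix.mat (dim_row A * dim_row B) (dim_col A * dim_col B)
     (\<lambda>(i, j). A $$ (i div dim_row B, j div dim_col B) * B $$ (i mod dim_row B, j mod dim_col B))"

text \<open>
  For strictly positive \<open>\<rho>\<close> and \<open>\<sigma>\<close> the matrix \<open>\<sigma> \<otimes> (\<rho>\<^sup>-\<^sup>1)\<^sup>T\<close> is Hermitian, so the quadratic form
  is real and \<open>Re\<close> only changes its type.
\<close>

definition quantum_f_relent :: "(real \<Rightarrow> real) \<Rightarrow> complex mat \<Rightarrow> complex mat \<Rightarrow> real" where
  "quantum_f_relent f \<rho> \<sigma> =
     (let v = vec_of_mat (herm_fun sqrt \<rho>)
      in Re ((herm_fun f (kron \<sigma> (transpose_mat (the (mat_inverse \<rho>)))) *\<^sub>v v) \<bullet>c v))"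

definition eigenvalue_ratios_in :: "complex mat \<Rightarrow> complex mat \<Rightarrow> real set \<Rightarrow> bool" where
  "eigenvalue_ratios_in \<rho> \<sigma> I \<longleftrightarrow>
     (\<forall>p q. eigenvalue \<rho> (complex_of_real p) \<longrightarrow> eigenvalue \<sigma> (complex_of_real q) \<longrightarrow> q / p \<in> I)"

text \<open>
  Partial trace over the second factor of a system of dimensions \<open>dA\<close> and \<open>dB\<close>; the product basis
  vector with components \<open>i\<close> and \<open>k\<close> has index \<open>i * dB + k\<close>.
\<close>

definition partial_trace_B :: "nat \<Rightarrow> nat \<Rightarrow> complex mat \<Rightarrow> complex mat" where
  "partial_trace_B dA dB M =
     Matrix.mat dA dA (\<lambda>(i, j). \<Sum>k<dB. M $$ (i * dB + k, j * dB + k))"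

end

theory Submission
  imports Defs
begin

text \<open>
  Let \<open>m\<close> be the difference of the finite measures
  \<open>\<Sum>\<^sub>i\<^sub>j p\<^sub>i |\<langle>i\<^sub>\<rho>|j\<^sub>\<sigma>\<rangle>|\<^sup>2 \<delta>(q\<^sub>j / p\<^sub>i)\<close> belonging to \<open>AB\<close> and to \<open>A\<close>. The two relative entropies
  differ by \<open>\<integral> f dm\<close> and the two traces by \<open>\<integral> r\<^sup>i\<^sup>t dm(r)\<close>, so each side of the equivalence
  holds if and only if \<open>m = 0\<close>. For the traces this follows by taking \<open>t = -in\<close>, which gives the moments of \<open>m\<close>.

  For the entropies, the mass and the mean of \<open>m\<close> vanish because the partial trace preserves
  traces, so \<open>\<integral> f dm\<close> is a positive multiple of \<open>\<integral> G(x) p(x) dx\<close> with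
  \<open>G(x) = \<integral> (r - t\<^sub>0)\<^sup>2 / (a\<^sup>2 - (r - t\<^sub>0) x) dm(r)\<close>. For \<open>x \<noteq> 0\<close> the integrand is, up to affine terms in \<open>r\<close>,
  a positive multiple of \<open>1 / (c\<^sub>1 + c\<^sub>2 r)\<close>, and for such functions the entropy is the supremum over
  \<open>Y\<close> of \<open>2 Re Tr(Y\<^sup>\<dagger> \<rho>) - c\<^sub>1 Tr(Y\<^sup>\<dagger> Y \<rho>) - c\<^sub>2 Tr(Y Y\<^sup>\<dagger> \<sigma>)\<close>; the value for \<open>A\<close> is attained on \<open>AB\<close> by
  \<open>Y \<otimes> 1\<close>, whence \<open>G(x) \<ge> 0\<close>. Equality therefore forces \<open>G = 0\<close> at infinitely many points, and since
  \<open>G\<close> is a sum of partial fractions with distinct poles, \<open>m\<close> vanishes off \<open>t\<^sub>0\<close>; having mass zero, it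
  vanishes.
\<close>

subsection \<open>Spectral theorem for Hermitian matrices\<close>

lemma index_mult_sum:
  assumes "A \<in> carrier_mat m n" "B \<in> carrier_mat n l" "i < m" "j < l"
  shows "(A * B) $$ (i, j) = (\<Sum>k<n. A $$ (i, k) * B $$ (k, j))"
  using assms by (auto simp: scalar_prod_def atLeast0LessThan intro!: sum.cong)

lemma index_mat_adjoint:
  fixes A :: "complex mat"
  assumes "A \<in> carrier_mat m n" "i < n" "j < m"
  shows "mat_adjoint A $$ (i, j) = cnj (A $$ (j, i))"
  using assms unfolding mat_adjoint_def by (auto simp: mat_of_rows_def)

lemma adjoint_mult:
  fixes A B :: "complex mat"
  assumes "A \<in> carrier_mat m n" "B \<in> carrier_mat n l"
  shows "mat_adjoint (A * B) = mat_adjoint B * mat_adjoint A"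
proof (rule eq_matI)
  have c: "A * B \<in> carrier_mat m l" "mat_adjoint A \<in> carrier_mat n m" "mat_adjoint B \<in> carrier_mat l n"
    using assms mat_adjoint_carrier by auto
  show "dim_row (mat_adjoint (A * B)) = dim_row (mat_adjoint B * mat_adjoint A)"
    "dim_col (mat_adjoint (A * B)) = dim_col (mat_adjoint B * mat_adjoint A)"
    using c mat_adjoint_carrier[OF c(1)] by auto
  fix i j assume "i < dim_row (mat_adjoint B * mat_adjoint A)" "j < dim_col (mat_adjoint B * mat_adjoint A)"
  then have ij: "i < l" "j < m" using c by auto
  show "mat_adjoint (A * B) $$ (i, j) = (mat_adjoint B * mat_adjoint A) $$ (i, j)"
    unfolding index_mat_adjoint[OF c(1) ij] index_mult_sum[OF assms ij(2,1)]
      index_mult_sum[OF c(3,2) ij]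
    by (auto simp: index_mat_adjoint[OF assms(1)] index_mat_adjoint[OF assms(2)] ij intro!: sum.cong)
qed

lemma adjoint_adjoint:
  fixes A :: "complex mat"
  assumes "A \<in> carrier_mat m n"
  shows "mat_adjoint (mat_adjoint A) = A"
proof (rule eq_matI)
  note c = mat_adjoint_carrier[OF assms] mat_adjoint_carrier[OF mat_adjoint_carrier[OF assms]]
  show "dim_row (mat_adjoint (mat_adjoint A)) = dim_row A" "dim_col (mat_adjoint (mat_adjoint A)) = dim_col A"
    using c assms by auto
  fix i j assume "i < dim_row A" "j < dim_col A"
  then have "i < m" "j < n" using assms by auto
  then show "mat_adjoint (mat_adjoint A) $$ (i, j) = A $$ (i, j)"
    by (simp add: index_mat_adjoint[OF c(1)] index_mat_adjoint[OF assms])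
qed

lemma adjoint_mat_diag:
  "mat_adjoint (mat_diag n f) = mat_diag n (\<lambda>i. cnj (f i))"
proof (rule eq_matI)
  have c: "mat_diag n f \<in> carrier_mat n n" by simp
  note c' = mat_adjoint_carrier[OF this]
  show "dim_row (mat_adjoint (mat_diag n f)) = dim_row (mat_diag n (\<lambda>i. cnj (f i)))"
    "dim_col (mat_adjoint (mat_diag n f)) = dim_col (mat_diag n (\<lambda>i. cnj (f i)))"
    using c' by (auto simp: mat_diag_def)
  fix i j assume "i < dim_row (mat_diag n (\<lambda>i. cnj (f i)))" "j < dim_col (mat_diag n (\<lambda>i. cnj (f i)))"
  then have "i < n" "j < n" by (auto simp: mat_diag_def)
  then show "mat_adjoint (mat_diag n f) $$ (i, j) = mat_diag n (\<lambda>i. cnj (f i)) $$ (i, j)"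
    by (simp add: index_mat_adjoint[OF c], auto simp: mat_diag_def)
qed

section \<open>Unitary matrices\<close>

lemma unitary_comm:
  fixes U :: "complex mat"
  assumes "U \<in> carrier_mat n n" "mat_adjoint U * U = 1\<^sub>m n"
  shows "U * mat_adjoint U = 1\<^sub>m n"
  using mat_mult_left_right_inverse[OF mat_adjoint_carrier[OF assms(1)] assms] .

text \<open>A basis extending \<open>v\<close> is orthogonalized by Gram-Schmidt, which leaves its
  first vector alone, and the columns are then normalized. The scalar \<open>c\<close> is the
  normalizing factor; for deflation only the direction of the column matters.\<close>

lemma unitary_first_column:
  fixes v :: "complex Matrix.vec"
  assumes v: "v \<in> carrier_vec n" "v \<noteq> 0\<^sub>v n"
  obtains W c where "W \<in> carrier_mat n n" "mat_adjoint W * W = 1\<^sub>m n" "col W 0 = c \<cdot>\<^sub>v v"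
proof -
  interpret cof_vec_space n "TYPE(complex)" .
  define b where "b = basis_completion v"
  define ws where "ws = gram_schmidt n b"
  define W0 where "W0 = mat_of_cols n ws"
  from basis_completion[OF v, folded b_def]
  have b: "distinct b" "\<not> lin_dep (set b)" "set b \<subseteq> carrier_vec n" "hd b = v" "length b = n"
    by auto
  have n: "n > 0"
  proof (rule ccontr)
    assume "\<not> n > 0"
    then have "v = 0\<^sub>v n" using v(1) by (intro eq_vecI) auto
    then show False using v by simp
  qed
  then obtain vs where bv: "b = v # vs" using b by (cases b) auto
  from gram_schmidt_result[OF b(3,1,2) refl, folded ws_def]
  have ws: "set ws \<subseteq> carrier_vec n" "corthogonal ws" "length ws = n"
    by (auto simp: b(5))
  have hdws: "hd ws = v" using gram_schmidt_hd[OF v(1), of vs, folded bv] unfolding ws_def .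
  have W0: "W0 \<in> carrier_mat n n" using ws unfolding W0_def by auto
  have W0': "mat_adjoint W0 \<in> carrier_mat n n" using mat_adjoint_carrier[OF W0] .
  have col0: "col W0 0 = v"
    using hdws n ws unfolding W0_def by (cases ws) auto
  define D where "D = mat_adjoint W0 * W0"
  have D: "D \<in> carrier_mat n n" using W0 W0' unfolding D_def by auto
  have orth: "corthogonal_mat W0" using orthogonal_mat_of_cols ws unfolding W0_def by blast
  have Dij: "D $$ (i, j) = (\<Sum>k<n. cnj (W0 $$ (k, i)) * W0 $$ (k, j))" if "i < n" "j < n" for i j
    unfolding D_def index_mult_sum[OF W0' W0 that]
    using that by (intro sum.cong refl) (simp add: index_mat_adjoint[OF W0])
  \<comment> \<open>The squared column norms of \<open>W0\<close>, which form the diagonal of the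
    Gram matrix \<open>D\<close>.\<close>
  define r where "r i = (\<Sum>k<n. (norm (W0 $$ (k, i)))\<^sup>2)" for i
  have Dr: "D $$ (i, i) = complex_of_real (r i)" if "i < n" for i
    unfolding Dij[OF that that] r_def of_real_sum
    by (intro sum.cong refl, subst complex_norm_square) (rule mult.commute)
  have D0: "D $$ (i, i) \<noteq> 0" if "i < n" for i
    using orth that W0 unfolding corthogonal_mat_def D_def Let_def by auto
  have Dne: "D $$ (i, j) = 0" if "i < n" "j < n" "i \<noteq> j" for i j
  proof -
    have "diagonal_mat D" using orth unfolding corthogonal_mat_def D_def Let_def by blast
    then show ?thesis using that D unfolding diagonal_mat_def by auto
  qed
  have r: "r i > 0" if "i < n" for i
    using Dr[OF that] D0[OF that] sum_nonneg[of "{..<n}" "\<lambda>k. (norm (W0 $$ (k, i)))\<^sup>2"]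
    unfolding r_def[symmetric] by (cases "r i = 0") auto
  define W where "W = W0 * mat_diag n (\<lambda>i. complex_of_real (1 / sqrt (r i)))"
  have W: "W \<in> carrier_mat n n" unfolding W_def using W0 by auto
  have Wij: "W $$ (i, j) = W0 $$ (i, j) * complex_of_real (1 / sqrt (r j))" if "i < n" "j < n" for i j
    unfolding W_def mat_diag_mult_right[OF W0] using that by simp
  have W': "mat_adjoint W \<in> carrier_mat n n" using mat_adjoint_carrier[OF W] .
  have "mat_adjoint W * W = 1\<^sub>m n"
  proof (rule eq_matI)
    fix i j assume "i < dim_row (1\<^sub>m n :: complex mat)" "j < dim_col (1\<^sub>m n :: complex mat)"
    then have ij: "i < n" "j < n" by auto
    have "(mat_adjoint W * W) $$ (i, j) =
      (\<Sum>k<n. complex_of_real (1 / sqrt (r i) * (1 / sqrt (r j))) * (cnj (W0 $$ (k, i)) * W0 $$ (k, j)))"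
      unfolding index_mult_sum[OF W' W ij]
      using ij by (intro sum.cong refl) (simp add: index_mat_adjoint[OF W] Wij)
    also have "\<dots> = complex_of_real (1 / sqrt (r i) * (1 / sqrt (r j))) * D $$ (i, j)"
      unfolding Dij[OF ij] sum_distrib_left ..
    also have "\<dots> = 1\<^sub>m n $$ (i, j)"
    proof (cases "i = j")
      case True
      have "complex_of_real (1 / sqrt (r i) * (1 / sqrt (r i))) * complex_of_real (r i) = 1"
        using r[OF ij(1)] unfolding of_real_mult[symmetric] by (simp add: field_simps)
      then show ?thesis using True ij Dr[OF ij(1)] by simp
    qed (use Dne ij in simp)
    finally show "(mat_adjoint W * W) $$ (i, j) = 1\<^sub>m n $$ (i, j)" .
  qed (use W W' in auto)
  moreover have "col W 0 = complex_of_real (1 / sqrt (r 0)) \<cdot>\<^sub>v v"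
    unfolding col0[symmetric] using W W0 n by (intro eq_vecI) (auto simp: Wij)
  ultimately show ?thesis using that W by blast
qed

lemma mult_conj_cancel:
  fixes U :: "complex mat"
  assumes U: "U \<in> carrier_mat n n" "mat_adjoint U * U = 1\<^sub>m n" and A: "A \<in> carrier_mat n n"
  shows "U * (mat_adjoint U * A * U) * mat_adjoint U = A"
proof -
  note U' = mat_adjoint_carrier[OF U(1)]
  have "U * (mat_adjoint U * A * U) * mat_adjoint U = (U * mat_adjoint U) * A * (U * mat_adjoint U)"
    using U(1) U' A by (simp add: assoc_mult_mat[where n\<^sub>1 = n and n\<^sub>2 = n and n\<^sub>3 = n and n\<^sub>4 = n])
  then show ?thesis using A by (simp add: unitary_comm[OF U])
qed

text \<open>Deflation by induction on the dimension: conjugation by a unitary whose first column is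
  an eigenvector clears the first column below the corner, hermiticity clears the first row as well,
  and a Hermitian block of size \<open>m\<close> remains.\<close>

theorem spectral_theorem:
  assumes "hermitian_mat n A"
  shows "\<exists>U d. spectral_decomp A U d"
  using assms
proof (induction n arbitrary: A)
  case 0
  then have A: "A \<in> carrier_mat 0 0" by (simp add: hermitian_mat_def)
  have "spectral_decomp A (1\<^sub>m 0) (\<lambda>_. 0)"
    unfolding spectral_decomp_def
    by (rule exI[of _ 0]) (use A in \<open>auto intro!: eq_matI simp: mat_adjoint_def mat_of_rows_def\<close>)
  then show ?case by blast
next
  case (Suc m)
  let ?n = "Suc m"
  have A: "A \<in> carrier_mat ?n ?n" and AA: "mat_adjoint A = A" using Suc.prems by (auto simp: hermitian_mat_def)
  have assoc: "(X * Y) * Z = X * (Y * Z)"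
    if "X \<in> carrier_mat ?n ?n" "Y \<in> carrier_mat ?n ?n" "Z \<in> carrier_mat ?n ?n" for X Y Z :: "complex mat"
    using that by (rule assoc_mult_mat)
  obtain e where "eigenvalue A e" using spectrum_non_empty[OF A] unfolding spectrum_def by auto
  then obtain v where v: "v \<in> carrier_vec ?n" "v \<noteq> 0\<^sub>v ?n" "A *\<^sub>v v = e \<cdot>\<^sub>v v"
    using A unfolding eigenvalue_def eigenvector_def by auto
  obtain W c where W: "W \<in> carrier_mat ?n ?n" "mat_adjoint W * W = 1\<^sub>m ?n" "col W 0 = c \<cdot>\<^sub>v v"
    using unitary_first_column[OF v(1,2)] by metis
  define W' where "W' = mat_adjoint W"
  have W': "W' \<in> carrier_mat ?n ?n" unfolding W'_def using mat_adjoint_carrier[OF W(1)] .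
  have W'W: "W' * W = 1\<^sub>m ?n" "W * W' = 1\<^sub>m ?n"
    using W(2) unitary_comm[OF W(1,2)] unfolding W'_def by auto
  define B where "B = W' * A * W"
  have B: "B \<in> carrier_mat ?n ?n" using W W' A unfolding B_def by auto
  have BB: "mat_adjoint B = B"
    unfolding B_def using W W' A
    by (simp add: adjoint_mult[where m = ?n and n = ?n and l = ?n] AA W'_def
          adjoint_adjoint[OF W(1)] assoc)
  have AB: "A = W * B * W'" using mult_conj_cancel[OF W(1,2) A] unfolding B_def W'_def by simp
  \<comment> \<open>The first column of \<open>W\<close> is an eigenvector, so \<open>A\<close>
    scales it and \<open>W'\<close> sends it back to the first unit vector.\<close>
  have colB: "B $$ (i, 0) = (if i = 0 then e else 0)" if "i < ?n" for i
  proof -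
    have "col B 0 = B *\<^sub>v unit_vec ?n 0" using B by (auto intro!: eq_vecI simp: scalar_prod_right_unit)
    also have "\<dots> = W' *\<^sub>v (A *\<^sub>v (W *\<^sub>v unit_vec ?n 0))"
      unfolding B_def using W W' A by (simp add: assoc_mult_mat_vec[of _ ?n ?n _ ?n])
    also have W0: "W *\<^sub>v unit_vec ?n 0 = col W 0" using W(1) by (auto intro!: eq_vecI simp: scalar_prod_right_unit)
    also have "A *\<^sub>v col W 0 = e \<cdot>\<^sub>v col W 0"
      unfolding W(3) using v A by (simp add: mult_mat_vec smult_smult_assoc mult.commute)
    also have "col W 0 = W *\<^sub>v unit_vec ?n 0" by (rule W0[symmetric])
    also have "W' *\<^sub>v (e \<cdot>\<^sub>v (W *\<^sub>v unit_vec ?n 0)) = e \<cdot>\<^sub>v (W' *\<^sub>v (W *\<^sub>v unit_vec ?n 0))"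
      using W W' by (intro mult_mat_vec[of _ ?n ?n]) auto
    also have "W' *\<^sub>v (W *\<^sub>v unit_vec ?n 0) = (W' * W) *\<^sub>v unit_vec ?n 0"
      using W W' by (simp add: assoc_mult_mat_vec[of _ ?n ?n _ ?n])
    finally have "col B 0 = e \<cdot>\<^sub>v unit_vec ?n 0" by (simp add: W'W)
    then have "vec_index (col B 0) i = vec_index (e \<cdot>\<^sub>v unit_vec ?n 0) i" by simp
    then show ?thesis using that B by (auto simp: unit_vec_def)
  qed
  have Bsym: "B $$ (i, j) = cnj (B $$ (j, i))" if "i < ?n" "j < ?n" for i j
    using index_mat_adjoint[OF B that] BB by simp
  \<comment> \<open>The corner is a diagonal entry of a Hermitian matrix, hence real; this justifies
    \<open>Re e\<close> as an eigenvalue below.\<close>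
  have e: "cnj e = e" using Bsym[of 0 0] colB[of 0] by simp
  have rowB: "B $$ (0, i) = (if i = 0 then e else 0)" if "i < ?n" for i
    using Bsym[of 0 i] colB[OF that] that e by auto
  define A3 where "A3 = Matrix.mat m m (\<lambda>(i, j). B $$ (Suc i, Suc j))"
  have A3: "A3 \<in> carrier_mat m m" unfolding A3_def by auto
  have A3h: "hermitian_mat m A3"
    unfolding hermitian_mat_def
  proof (intro conjI A3 eq_matI)
    fix i j assume "i < dim_row A3" "j < dim_col A3"
    then have ij: "i < m" "j < m" using A3 by auto
    show "mat_adjoint A3 $$ (i, j) = A3 $$ (i, j)"
      using index_mat_adjoint[OF A3 ij] Bsym[of "Suc i" "Suc j"] ij unfolding A3_def by simp
  qed (use A3 mat_adjoint_carrier[OF A3] in auto)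
  obtain V d where "spectral_decomp A3 V d" using Suc.IH[OF A3h] by blast
  then have V: "V \<in> carrier_mat m m" "mat_adjoint V * V = 1\<^sub>m m"
    "A3 = V * mat_diag m (\<lambda>i. complex_of_real (d i)) * mat_adjoint V"
    using A3 unfolding spectral_decomp_def by auto
  note V' = mat_adjoint_carrier[OF V(1)]
  \<comment> \<open>\<open>X\<close> is the block sum of the scalar 1 and \<open>V\<close>, and
    \<open>d'\<close> puts the new eigenvalue in front of those of the block.\<close>
  define X where "X = Matrix.mat ?n ?n (\<lambda>(i, j). case (i, j) of
      (Suc i', Suc j') \<Rightarrow> V $$ (i', j') | (0, 0) \<Rightarrow> 1 | _ \<Rightarrow> 0)"
  define d' where "d' i = (case i of 0 \<Rightarrow> Re e | Suc i' \<Rightarrow> d i')" for i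
  have X: "X \<in> carrier_mat ?n ?n" unfolding X_def by auto
  note X' = mat_adjoint_carrier[OF X]
  have X0: "X $$ (0, Suc i) = 0" "X $$ (Suc i, 0) = 0"
    and XS: "X $$ (Suc i, Suc j) = V $$ (i, j)" if "i < m" "j < m" for i j
    using that unfolding X_def by auto
  have X00: "X $$ (0, 0) = 1" unfolding X_def by auto
  have XX: "mat_adjoint X * X = 1\<^sub>m ?n"
  proof (rule eq_matI)
    fix i j assume "i < dim_row (1\<^sub>m ?n :: complex mat)" "j < dim_col (1\<^sub>m ?n :: complex mat)"
    then have ij: "i < ?n" "j < ?n" by auto
    have *: "(mat_adjoint X * X) $$ (i, j) = (\<Sum>k<?n. cnj (X $$ (k, i)) * X $$ (k, j))"
      unfolding index_mult_sum[OF X' X ij]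
      using ij by (intro sum.cong refl) (simp add: index_mat_adjoint[OF X])
    have **: "(\<Sum>k<m. cnj (V $$ (k, i)) * V $$ (k, j)) = 1\<^sub>m m $$ (i, j)" if "i < m" "j < m" for i j
      unfolding V(2)[symmetric] index_mult_sum[OF V' V(1) that]
      using that by (intro sum.cong refl) (simp add: index_mat_adjoint[OF V(1)])
    show "(mat_adjoint X * X) $$ (i, j) = 1\<^sub>m ?n $$ (i, j)"
      unfolding * sum.lessThan_Suc_shift
      using ij ** by (cases i; cases j) (auto simp: X00 X0 XS)
  qed (use X X' in auto)
  have BX: "B = X * mat_diag ?n (\<lambda>i. complex_of_real (d' i)) * mat_adjoint X" (is "B = ?R")
  proof (rule eq_matI)
    fix i j assume "i < dim_row ?R" "j < dim_col ?R"
    then have ij: "i < ?n" "j < ?n" using X X' by auto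
    have XD: "X * mat_diag ?n (\<lambda>i. complex_of_real (d' i)) \<in> carrier_mat ?n ?n" using X by auto
    have *: "?R $$ (i, j) = (\<Sum>k<?n. X $$ (i, k) * d' k * cnj (X $$ (j, k)))"
      unfolding index_mult_sum[OF XD X' ij]
      unfolding mat_diag_mult_right[OF X]
      using ij by (intro sum.cong refl) (simp add: index_mat_adjoint[OF X])
    have VD: "V * mat_diag m (\<lambda>i. complex_of_real (d i)) \<in> carrier_mat m m" using V by auto
    have **: "(\<Sum>k<m. V $$ (i, k) * d k * cnj (V $$ (j, k))) = A3 $$ (i, j)" if "i < m" "j < m" for i j
      unfolding V(3) index_mult_sum[OF VD V' that]
      unfolding mat_diag_mult_right[OF V(1)]
      using that by (intro sum.cong refl) (simp add: index_mat_adjoint[OF V(1)])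
    have e': "complex_of_real (Re e) = e" using e by (metis Reals_cnj_iff of_real_Re)
    show "B $$ (i, j) = ?R $$ (i, j)"
      unfolding * sum.lessThan_Suc_shift
      using ij ** colB[OF ij(1)] rowB[OF ij(2)]
      by (cases i; cases j) (auto simp: X00 X0 XS d'_def e' A3_def)
  qed (use X X' B in auto)
  define U where "U = W * X"
  have U: "U \<in> carrier_mat ?n ?n" using W X unfolding U_def by auto
  have Uadj: "mat_adjoint U = mat_adjoint X * W'"
    unfolding U_def W'_def using adjoint_mult[OF W(1) X] .
  have "mat_adjoint U * U = mat_adjoint X * ((W' * W) * X)"
    unfolding Uadj unfolding U_def using W W' X X' by (simp add: assoc)
  also have "\<dots> = 1\<^sub>m ?n" unfolding W'W using X XX by simp
  finally have UU: "mat_adjoint U * U = 1\<^sub>m ?n" .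
  define D where "D = mat_diag ?n (\<lambda>i. complex_of_real (d' i))"
  have D: "D \<in> carrier_mat ?n ?n" unfolding D_def by simp
  have "A = W * (X * D * mat_adjoint X) * W'" using AB BX unfolding D_def by simp
  also have "\<dots> = U * D * mat_adjoint U"
    unfolding Uadj unfolding U_def using W W' X X' D by (simp add: assoc)
  finally have "spectral_decomp A U d'"
    unfolding spectral_decomp_def D_def using A U UU by blast
  then show ?case by blast
qed

subsection \<open>Functional calculus and traces\<close>

lemma index_mult_mat_vec_sum:
  assumes "A \<in> carrier_mat m n" "v \<in> carrier_vec n" "i < m"
  shows "vec_index (A *\<^sub>v v) i = (\<Sum>k<n. A $$ (i, k) * vec_index v k)"
  using assms by (auto simp: scalar_prod_def atLeast0LessThan intro!: sum.cong)

lemma spectral_decompD: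
  assumes "spectral_decomp A U d" "A \<in> carrier_mat n n"
  shows "U \<in> carrier_mat n n" "mat_adjoint U * U = 1\<^sub>m n"
    "A = U * mat_diag n (\<lambda>i. complex_of_real (d i)) * mat_adjoint U"
  using assms unfolding spectral_decomp_def by auto

lemma spectral_decompI:
  assumes "U \<in> carrier_mat n n" "mat_adjoint U * U = 1\<^sub>m n"
    "A = U * mat_diag n (\<lambda>i. complex_of_real (d i)) * mat_adjoint U"
  shows "spectral_decomp A U d"
  unfolding spectral_decomp_def
  by (rule exI[of _ n]) (use assms mat_adjoint_carrier[OF assms(1)] in auto)

lemma conj_diag_carrier:
  fixes U :: "complex mat"
  assumes "U \<in> carrier_mat n n"
  shows "U * mat_diag n d * mat_adjoint U \<in> carrier_mat n n"
  using assms mat_adjoint_carrier[OF assms] by auto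

lemma index_conj_diag:
  fixes U :: "complex mat"
  assumes U: "U \<in> carrier_mat n n" and ij: "i < n" "j < n"
  shows "(U * mat_diag n d * mat_adjoint U) $$ (i, j) = (\<Sum>k<n. U $$ (i, k) * d k * cnj (U $$ (j, k)))"
proof -
  have UD: "U * mat_diag n d \<in> carrier_mat n n" using U by auto
  show ?thesis
    unfolding index_mult_sum[OF UD mat_adjoint_carrier[OF U] ij]
    unfolding mat_diag_mult_right[OF U]
    using ij by (intro sum.cong refl) (simp add: index_mat_adjoint[OF U])
qed

lemma conj_diag_mult:
  fixes U :: "complex mat"
  assumes U: "U \<in> carrier_mat n n" "mat_adjoint U * U = 1\<^sub>m n"
  shows "(U * mat_diag n d * mat_adjoint U) * (U * mat_diag n e * mat_adjoint U) =
    U * mat_diag n (\<lambda>i. d i * e i) * mat_adjoint U"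
proof -
  note U' = mat_adjoint_carrier[OF U(1)]
  have UD: "U * mat_diag n d \<in> carrier_mat n n" using U(1) by auto
  have "(U * mat_diag n d * mat_adjoint U) * (U * mat_diag n e * mat_adjoint U) =
    U * mat_diag n d * (mat_adjoint U * U) * mat_diag n e * mat_adjoint U"
    using U(1) U' by (simp add: assoc_mult_mat[of _ n n _ n _ n] mult_carrier_mat[of _ n n _ n])
  also have "\<dots> = U * (mat_diag n d * mat_diag n e) * mat_adjoint U"
    unfolding U(2) right_mult_one_mat[OF UD] using U(1) U' by (simp add: assoc_mult_mat[of _ n n _ n _ n] mult_carrier_mat[of _ n n _ n])
  finally show ?thesis by simp
qed

lemma conj_diag_one:
  fixes U :: "complex mat"
  assumes U: "U \<in> carrier_mat n n" "mat_adjoint U * U = 1\<^sub>m n"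
  shows "U * mat_diag n (\<lambda>_. 1) * mat_adjoint U = 1\<^sub>m n"
  using unitary_comm[OF U] U(1) by simp

lemma conj_diag_smult:
  fixes U :: "complex mat"
  assumes U: "U \<in> carrier_mat n n"
  shows "z \<cdot>\<^sub>m (U * mat_diag n d * mat_adjoint U) = U * mat_diag n (\<lambda>i. z * d i) * mat_adjoint U"
    (is "?L = ?R")
proof (rule eq_matI)
  note c = conj_diag_carrier[OF U]
  fix i j assume "i < dim_row ?R" "j < dim_col ?R"
  then have ij: "i < n" "j < n" using c[of "\<lambda>i. z * d i"] by auto
  have "?L $$ (i, j) = z * (U * mat_diag n d * mat_adjoint U) $$ (i, j)"
    using c[of d] ij by (intro index_smult_mat) auto
  then show "?L $$ (i, j) = ?R $$ (i, j)"
    unfolding index_conj_diag[OF U ij] by (simp add: sum_distrib_left algebra_simps)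
qed (use U mat_adjoint_carrier[OF U] in auto)

lemma conj_diag_pow:
  fixes U :: "complex mat"
  assumes U: "U \<in> carrier_mat n n" "mat_adjoint U * U = 1\<^sub>m n"
  shows "(U * mat_diag n d * mat_adjoint U) ^\<^sub>m k = U * mat_diag n (\<lambda>i. d i ^ k) * mat_adjoint U"
proof (induction k)
  case 0
  have "dim_row (U * mat_diag n d * mat_adjoint U) = n" using U(1) by auto
  then show ?case using conj_diag_one[OF U] by simp
next
  case (Suc k)
  then show ?case by (simp add: conj_diag_mult[OF U] mult.commute)
qed

text \<open>Powers act on the diagonal only, so each entry of the exponential series is a finite
  combination of scalar exponential series.\<close>

lemma mat_exp_conj_diag:
  fixes U :: "complex mat"
  assumes U: "U \<in> carrier_mat n n" "mat_adjoint U * U = 1\<^sub>m n"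
  shows "mat_exp (U * mat_diag n d * mat_adjoint U) = U * mat_diag n (\<lambda>i. exp (d i)) * mat_adjoint U"
    (is "mat_exp ?A = ?R")
proof (rule eq_matI)
  note c = conj_diag_carrier[OF U(1)]
  have dims: "dim_row ?A = n" "dim_col ?A = n" using c[of d] by auto
  show "dim_row (mat_exp ?A) = dim_row ?R" "dim_col (mat_exp ?A) = dim_col ?R"
    using U(1) mat_adjoint_carrier[OF U(1)] by (auto simp: mat_exp_def)
  fix i j assume "i < dim_row ?R" "j < dim_col ?R"
  then have ij: "i < n" "j < n" using c[of "\<lambda>i. exp (d i)"] by auto
  have "(\<lambda>k. \<Sum>l<n. U $$ (i, l) * (d l ^ k / fact k) * cnj (U $$ (j, l))) sums
    (\<Sum>l<n. U $$ (i, l) * exp (d l) * cnj (U $$ (j, l)))"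
    using exp_converges[where 'a = complex]
    by (intro sums_sum sums_mult sums_mult2) (simp add: scaleR_conv_of_real field_simps)
  also have "(\<lambda>k. \<Sum>l<n. U $$ (i, l) * (d l ^ k / fact k) * cnj (U $$ (j, l))) =
    (\<lambda>k. (?A ^\<^sub>m k) $$ (i, j) / fact k)"
    unfolding conj_diag_pow[OF U] index_conj_diag[OF U(1) ij] by (simp add: sum_divide_distrib)
  finally have "(\<Sum>k. (?A ^\<^sub>m k) $$ (i, j) / fact k) = ?R $$ (i, j)"
    unfolding index_conj_diag[OF U(1) ij] by (rule sums_unique[symmetric])
  then show "mat_exp ?A $$ (i, j) = ?R $$ (i, j)"
    unfolding mat_exp_def dims using ij by simp
qed

lemma herm_fun_conj_diag:
  assumes "spectral_decomp A U d" "A \<in> carrier_mat n n"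
  shows "herm_fun f A = U * mat_diag n (\<lambda>i. complex_of_real (f (d i))) * mat_adjoint U"
  using herm_fun_eq[OF assms(1)] assms(2) by simp

lemma mat_cpow_conj_diag:
  assumes "spectral_decomp A U d" "A \<in> carrier_mat n n"
  shows "mat_cpow A z = U * mat_diag n (\<lambda>i. exp (z * complex_of_real (ln (d i)))) * mat_adjoint U"
  unfolding mat_cpow_def herm_fun_conj_diag[OF assms] conj_diag_smult[OF spectral_decompD(1)[OF assms]]
  by (rule mat_exp_conj_diag[OF spectral_decompD(1,2)[OF assms]])

section \<open>Traces and quadratic forms in diagonalized form\<close>

lemma trace_mult:
  fixes A B :: "'a :: comm_semiring_0 mat"
  assumes "A \<in> carrier_mat m n" "B \<in> carrier_mat n m"
  shows "mat_trace (A * B) = (\<Sum>i<m. \<Sum>k<n. A $$ (i, k) * B $$ (k, i))"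
  unfolding mat_trace_def using assms
  by (intro sum.cong) (auto simp: index_mult_sum simp del: index_mult_mat(1))

lemma trace_mult_commute:
  fixes A B :: "'a :: comm_semiring_0 mat"
  assumes "A \<in> carrier_mat m n" "B \<in> carrier_mat n m"
  shows "mat_trace (A * B) = mat_trace (B * A)"
  unfolding trace_mult[OF assms] trace_mult[OF assms(2,1)]
  by (subst sum.swap) (simp add: mult.commute)

text \<open>
  If the columns of \<open>U\<close> and \<open>V\<close> are eigenvectors of \<open>\<rho>\<close> and \<open>\<sigma>\<close>, then \<open>mat_adjoint V * U\<close>
  has the entries \<open>\<langle>j\<^sub>\<sigma>|i\<^sub>\<rho>\<rangle>\<close>.
\<close>

lemma trace_conj_diag_mult:
  fixes U V :: "complex mat"
  assumes U: "U \<in> carrier_mat n n" and V: "V \<in> carrier_mat n n"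
  shows "mat_trace ((V * mat_diag n e * mat_adjoint V) * (U * mat_diag n d * mat_adjoint U)) =
    (\<Sum>i<n. \<Sum>j<n. d i * e j * complex_of_real ((norm ((mat_adjoint V * U) $$ (j, i)))\<^sup>2))"
proof -
  note U' = mat_adjoint_carrier[OF U] and V' = mat_adjoint_carrier[OF V]
  have assoc: "(X * Y) * Z = X * (Y * Z)"
    if "X \<in> carrier_mat n n" "Y \<in> carrier_mat n n" "Z \<in> carrier_mat n n" for X Y Z :: "complex mat"
    using that by (rule assoc_mult_mat)
  note assoc = assoc mult_carrier_mat[of _ n n _ n]
  define G where "G = mat_adjoint V * U"
  have G: "G \<in> carrier_mat n n" and G': "mat_adjoint G \<in> carrier_mat n n"
    and Gadj: "mat_adjoint G = mat_adjoint U * V"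
    using U V U' V' by (auto simp: G_def adjoint_mult[OF V' U] adjoint_adjoint[OF V] intro: mat_adjoint_carrier)
  have c: "G * mat_diag n d * mat_adjoint G \<in> carrier_mat n n" using G G' by auto
  have "mat_trace ((V * mat_diag n e * mat_adjoint V) * (U * mat_diag n d * mat_adjoint U)) =
    mat_trace (V * (mat_diag n e * mat_adjoint V * (U * mat_diag n d * mat_adjoint U)))"
    using U V U' V' by (simp add: assoc)
  \<comment> \<open>Cyclicity of the trace brings \<open>V\<close> to the end, so that only the
    diagonals and the overlap matrix \<open>G\<close> remain.\<close>
  also have "\<dots> = mat_trace ((mat_diag n e * mat_adjoint V * (U * mat_diag n d * mat_adjoint U)) * V)"
    using U V U' V' by (intro trace_mult_commute[of _ n n] mult_carrier_mat[of _ n n _ n]) auto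
  also have "\<dots> = mat_trace (mat_diag n e * (G * mat_diag n d * mat_adjoint G))"
    unfolding Gadj unfolding G_def using U V U' V' by (simp add: assoc)
  also have "\<dots> = (\<Sum>j<n. e j * (G * mat_diag n d * mat_adjoint G) $$ (j, j))"
    unfolding mat_diag_mult_left[OF c] by (simp add: mat_trace_def)
  also have "\<dots> = (\<Sum>j<n. \<Sum>i<n. d i * e j * complex_of_real ((norm (G $$ (j, i)))\<^sup>2))"
  proof (intro sum.cong refl)
    fix j assume "j \<in> {..<n}"
    then have j: "j < n" by simp
    show "e j * (G * mat_diag n d * mat_adjoint G) $$ (j, j) =
      (\<Sum>i<n. d i * e j * complex_of_real ((norm (G $$ (j, i)))\<^sup>2))"
      unfolding index_conj_diag[OF G j j] sum_distrib_left
      by (intro sum.cong refl) (simp only: complex_norm_square ac_simps)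
  qed
  also have "\<dots> = (\<Sum>i<n. \<Sum>j<n. d i * e j * complex_of_real ((norm (G $$ (j, i)))\<^sup>2))"
    by (rule sum.swap)
  finally show ?thesis unfolding G_def .
qed

lemma quadratic_form_conj_diag:
  fixes U :: "complex mat"
  assumes U: "U \<in> carrier_mat n n" and v: "v \<in> carrier_vec n"
  shows "Re (((U * mat_diag n (\<lambda>i. complex_of_real (d i)) * mat_adjoint U) *\<^sub>v v) \<bullet>c v) =
    (\<Sum>i<n. d i * (norm (\<Sum>k<n. cnj (U $$ (k, i)) * vec_index v k))\<^sup>2)"
proof -
  \<comment> \<open>\<open>y\<close> is the adjoint of \<open>U\<close> applied to \<open>v\<close>;
    in terms of \<open>y\<close> the form is diagonal.\<close>
  define y where "y i = (\<Sum>k<n. cnj (U $$ (k, i)) * vec_index v k)" for i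
  let ?A = "U * mat_diag n (\<lambda>i. complex_of_real (d i)) * mat_adjoint U"
  note c = conj_diag_carrier[OF U, of "\<lambda>i. complex_of_real (d i)"]
  have Av: "vec_index (?A *\<^sub>v v) l = (\<Sum>i<n. U $$ (l, i) * d i * y i)" if "l < n" for l
  proof -
    have "vec_index (?A *\<^sub>v v) l = (\<Sum>k<n. ?A $$ (l, k) * vec_index v k)"
      by (rule index_mult_mat_vec_sum[OF c v that])
    also have "\<dots> = (\<Sum>k<n. \<Sum>i<n. U $$ (l, i) * d i * cnj (U $$ (k, i)) * vec_index v k)"
      using that by (intro sum.cong refl) (simp add: index_conj_diag[OF U] sum_distrib_right del: index_mult_mat(1))
    also have "\<dots> = (\<Sum>i<n. U $$ (l, i) * d i * y i)"
      unfolding y_def by (subst sum.swap) (simp add: sum_distrib_left mult.assoc)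
    finally show ?thesis .
  qed
  have "(?A *\<^sub>v v) \<bullet>c v = (\<Sum>l<n. vec_index (?A *\<^sub>v v) l * cnj (vec_index v l))"
    using v by (auto simp: scalar_prod_def atLeast0LessThan simp del: index_mult_mat_vec intro!: sum.cong)
  also have "\<dots> = (\<Sum>l<n. \<Sum>i<n. U $$ (l, i) * d i * y i * cnj (vec_index v l))"
    by (intro sum.cong refl) (simp add: Av sum_distrib_right)
  also have "\<dots> = (\<Sum>i<n. d i * (y i * cnj (y i)))"
    by (subst sum.swap) (simp add: y_def sum_distrib_left algebra_simps)
  also have "\<dots> = complex_of_real (\<Sum>i<n. d i * (norm (y i))\<^sup>2)"
    unfolding of_real_sum of_real_mult complex_norm_square ..
  finally show ?thesis unfolding y_def by (simp only: Re_complex_of_real)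
qed

section \<open>Eigenvalues and positivity\<close>

text \<open>\<open>A * U\<close> is \<open>U\<close> with its columns scaled, so the columns of
  \<open>U\<close> are eigenvectors. This links the diagonal entries to the condition on the ratios,
  which speaks of \<open>eigenvalue\<close>.\<close>

lemma spectral_eigenvalue:
  assumes "spectral_decomp A U d" "A \<in> carrier_mat n n" "i < n"
  shows "eigenvalue A (complex_of_real (d i))"
proof -
  note s = spectral_decompD[OF assms(1,2)]
  note U' = mat_adjoint_carrier[OF s(1)]
  let ?D = "mat_diag n (\<lambda>i. complex_of_real (d i))"
  have "A * U = U * ?D * (mat_adjoint U * U)"
    unfolding s(3) using s(1) U' by (simp add: assoc_mult_mat[of _ n n _ n _ n] mult_carrier_mat[of _ n n _ n])
  then have AU: "A * U = Matrix.mat n n (\<lambda>(k, j). U $$ (k, j) * complex_of_real (d j))"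
    unfolding s(2) using s(1) by (simp add: mat_diag_mult_right[OF s(1)])
  have "A *\<^sub>v col U i = col (A * U) i" using assms s(1) by auto
  also have "\<dots> = complex_of_real (d i) \<cdot>\<^sub>v col U i" unfolding AU using assms s(1) by (intro eq_vecI) auto
  finally have *: "A *\<^sub>v col U i = complex_of_real (d i) \<cdot>\<^sub>v col U i" .
  have "col U i \<noteq> 0\<^sub>v n"
  proof
    assume "col U i = 0\<^sub>v n"
    then have z: "U $$ (k, i) = 0" if "k < n" for k
      using that assms(3) s(1) by (metis carrier_matD index_col index_zero_vec(1))
    have "(mat_adjoint U * U) $$ (i, i) = 0"
      unfolding index_mult_sum[OF U' s(1) assms(3) assms(3)] using z by simp
    then show False unfolding s(2) using assms(3) by simp
  qed
  then show ?thesis unfolding eigenvalue_def eigenvector_def using * assms s(1)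
    by (intro exI[of _ "col U i"]) auto
qed

text \<open>Positivity tested on an eigenvector \<open>v\<close> says that \<open>d i\<close> times
  the squared norm of \<open>v\<close> is positive.\<close>

lemma strictly_positive_decomp:
  assumes "strictly_positive_mat n A"
  obtains U d where "spectral_decomp A U d" "\<And>i. i < n \<Longrightarrow> d i > 0"
proof -
  have h: "hermitian_mat n A" using assms by (simp add: strictly_positive_mat_def)
  then have A: "A \<in> carrier_mat n n" by (simp add: hermitian_mat_def)
  obtain U d where s: "spectral_decomp A U d" using spectral_theorem[OF h] by blast
  have "d i > 0" if i: "i < n" for i
  proof -
    obtain v where v: "v \<in> carrier_vec n" "v \<noteq> 0\<^sub>v n" "A *\<^sub>v v = complex_of_real (d i) \<cdot>\<^sub>v v"
      using spectral_eigenvalue[OF s A i] A unfolding eigenvalue_def eigenvector_def by auto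
    have "(A *\<^sub>v v) \<bullet>c v = complex_of_real (d i) * (v \<bullet>c v)" unfolding v(3) using v(1) by simp
    also have "v \<bullet>c v = complex_of_real (\<Sum>k<n. (norm (vec_index v k))\<^sup>2)"
      using v(1) unfolding of_real_sum complex_norm_square
      by (auto simp: scalar_prod_def atLeast0LessThan intro!: sum.cong)
    also have "complex_of_real (d i) * \<dots> = complex_of_real (d i * (\<Sum>k<n. (norm (vec_index v k))\<^sup>2))"
      by simp
    finally have "Re ((A *\<^sub>v v) \<bullet>c v) = d i * (\<Sum>k<n. (norm (vec_index v k))\<^sup>2)"
      by (simp only: Re_complex_of_real)
    moreover have "Re ((A *\<^sub>v v) \<bullet>c v) > 0" using assms v unfolding strictly_positive_mat_def by blast
    moreover have "(\<Sum>k<n. (norm (vec_index v k))\<^sup>2) \<ge> 0" by (intro sum_nonneg) auto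
    ultimately show ?thesis by (simp add: zero_less_mult_iff)
  qed
  then show ?thesis using that s by blast
qed

subsection \<open>Kronecker products and the relative entropy\<close>

lemma div_mod_less:
  fixes i :: nat
  assumes "i < m * k"
  shows "i div k < m" "i mod k < k"
proof -
  have "k > 0" using assms by (cases k) auto
  then show "i div k < m" "i mod k < k" using assms by (auto simp: less_mult_imp_div_less)
qed

text \<open>Division with remainder by \<open>k\<close> is a bijection between the indices of a
  product space and pairs of indices.\<close>

lemma sum_div_mod:
  fixes f :: "nat \<Rightarrow> nat \<Rightarrow> 'a :: comm_monoid_add"
  shows "(\<Sum>i<m * k. f (i div k) (i mod k)) = (\<Sum>a<m. \<Sum>b<k. f a b)"
proof -
  have "(\<Sum>a<m. \<Sum>b<k. f a b) = (\<Sum>(a, b)\<in>{..<m} \<times> {..<k}. f a b)"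
    by (rule sum.cartesian_product)
  also have "\<dots> = (\<Sum>i<m * k. f (i div k) (i mod k))"
  proof (rule sum.reindex_bij_witness[of _ "\<lambda>i. (i div k, i mod k)" "\<lambda>(a, b). a * k + b"])
    fix ab assume "ab \<in> {..<m} \<times> {..<k}"
    then obtain a b where ab: "ab = (a, b)" "a < m" "b < k" by auto
    have "a * k + b < Suc a * k" using ab by simp
    also have "\<dots> \<le> m * k" using ab by (intro mult_le_mono1) simp
    finally show "(case ab of (a, b) \<Rightarrow> a * k + b) \<in> {..<m * k}" using ab by simp
  qed (auto dest: div_mod_less)
  finally show ?thesis ..
qed

lemma kron_carrier:
  "A \<in> carrier_mat m n \<Longrightarrow> B \<in> carrier_mat k l \<Longrightarrow> kron A B \<in> carrier_mat (m * k) (n * l)"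
  unfolding kron_def by auto

lemma index_kron:
  assumes "A \<in> carrier_mat m n" "B \<in> carrier_mat k l" "i < m * k" "j < n * l"
  shows "kron A B $$ (i, j) = A $$ (i div k, j div l) * B $$ (i mod k, j mod l)"
  using assms unfolding kron_def by auto

text \<open>The mixed-product rule: a sum over an index of the product space factors into two
  sums.\<close>

lemma kron_mult:
  fixes A B C D :: "'a :: comm_semiring_0 mat"
  assumes A: "A \<in> carrier_mat m n" and B: "B \<in> carrier_mat k l"
    and C: "C \<in> carrier_mat n r" and D: "D \<in> carrier_mat l s"
  shows "kron A B * kron C D = kron (A * C) (B * D)"
proof (rule eq_matI)
  have AC: "A * C \<in> carrier_mat m r" and BD: "B * D \<in> carrier_mat k s" using assms by auto
  note AB = kron_carrier[OF A B] and CD = kron_carrier[OF C D] and ACBD = kron_carrier[OF AC BD]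
  show "dim_row (kron A B * kron C D) = dim_row (kron (A * C) (B * D))"
    "dim_col (kron A B * kron C D) = dim_col (kron (A * C) (B * D))"
    using AB CD ACBD by auto
  fix i j assume "i < dim_row (kron (A * C) (B * D))" "j < dim_col (kron (A * C) (B * D))"
  then have ij: "i < m * k" "j < r * s" using ACBD by auto
  note dm = div_mod_less[OF ij(1)] div_mod_less[OF ij(2)]
  have "(kron A B * kron C D) $$ (i, j) =
    (\<Sum>u<n * l. (A $$ (i div k, u div l) * B $$ (i mod k, u mod l)) *
      (C $$ (u div l, j div s) * D $$ (u mod l, j mod s)))"
    unfolding index_mult_sum[OF AB CD ij]
    using ij by (intro sum.cong refl) (simp add: index_kron[OF A B] index_kron[OF C D])
  also have "\<dots> = (\<Sum>a<n. \<Sum>b<l. (A $$ (i div k, a) * B $$ (i mod k, b)) *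
      (C $$ (a, j div s) * D $$ (b, j mod s)))"
    by (rule sum_div_mod)
  also have "\<dots> = (A * C) $$ (i div k, j div s) * (B * D) $$ (i mod k, j mod s)"
    unfolding index_mult_sum[OF A C dm(1,3)] index_mult_sum[OF B D dm(2,4)] sum_product
    by (simp add: ac_simps)
  also have "\<dots> = kron (A * C) (B * D) $$ (i, j)"
    by (rule index_kron[OF AC BD ij, symmetric])
  finally show "(kron A B * kron C D) $$ (i, j) = kron (A * C) (B * D) $$ (i, j)" .
qed

lemma kron_adjoint:
  fixes A B :: "complex mat"
  assumes A: "A \<in> carrier_mat m n" and B: "B \<in> carrier_mat k l"
  shows "mat_adjoint (kron A B) = kron (mat_adjoint A) (mat_adjoint B)"
proof (rule eq_matI)
  note A' = mat_adjoint_carrier[OF A] and B' = mat_adjoint_carrier[OF B]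
  note AB = kron_carrier[OF A B] and AB' = kron_carrier[OF A' B']
  show "dim_row (mat_adjoint (kron A B)) = dim_row (kron (mat_adjoint A) (mat_adjoint B))"
    "dim_col (mat_adjoint (kron A B)) = dim_col (kron (mat_adjoint A) (mat_adjoint B))"
    using mat_adjoint_carrier[OF AB] AB' by auto
  fix i j assume "i < dim_row (kron (mat_adjoint A) (mat_adjoint B))"
    "j < dim_col (kron (mat_adjoint A) (mat_adjoint B))"
  then have ij: "i < n * l" "j < m * k" using AB' by auto
  note dm = div_mod_less[OF ij(1)] div_mod_less[OF ij(2)]
  show "mat_adjoint (kron A B) $$ (i, j) = kron (mat_adjoint A) (mat_adjoint B) $$ (i, j)"
    unfolding index_mat_adjoint[OF AB ij] index_kron[OF A' B' ij] index_kron[OF A B ij(2,1)]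
      index_mat_adjoint[OF A dm(1,3)] index_mat_adjoint[OF B dm(2,4)] by simp
qed

lemma kron_mat_diag:
  fixes f g :: "nat \<Rightarrow> 'a :: semiring_0"
  shows "kron (mat_diag n f) (mat_diag m g) = mat_diag (n * m) (\<lambda>i. f (i div m) * g (i mod m))"
proof (rule eq_matI)
  note c = kron_carrier[OF mat_diag_dim[of n f] mat_diag_dim[of m g]]
  show "dim_row (kron (mat_diag n f) (mat_diag m g)) = dim_row (mat_diag (n * m) (\<lambda>i. f (i div m) * g (i mod m)))"
    "dim_col (kron (mat_diag n f) (mat_diag m g)) = dim_col (mat_diag (n * m) (\<lambda>i. f (i div m) * g (i mod m)))"
    using c by (auto simp: mat_diag_def)
  fix i j assume "i < dim_row (mat_diag (n * m) (\<lambda>i. f (i div m) * g (i mod m)))"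
    "j < dim_col (mat_diag (n * m) (\<lambda>i. f (i div m) * g (i mod m)))"
  then have ij: "i < n * m" "j < n * m" by (auto simp: mat_diag_def)
  note dm = div_mod_less[OF ij(1)] div_mod_less[OF ij(2)]
  \<comment> \<open>An index is determined by its two components, so an off-diagonal entry is
    off-diagonal in at least one factor.\<close>
  have "i = j" if "i div m = j div m" "i mod m = j mod m"
    using that by (metis div_mult_mod_eq)
  then show "kron (mat_diag n f) (mat_diag m g) $$ (i, j) = mat_diag (n * m) (\<lambda>i. f (i div m) * g (i mod m)) $$ (i, j)"
    unfolding index_kron[OF mat_diag_dim[of n f] mat_diag_dim[of m g] ij]
    using ij dm by (auto simp: mat_diag_def)
qed

lemma kron_one: "kron (1\<^sub>m n) (1\<^sub>m m) = (1\<^sub>m (n * m) :: 'a :: semiring_1 mat)"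
  using kron_mat_diag[of n "\<lambda>_. 1" m "\<lambda>_. 1 :: 'a"] by simp

text \<open>By the mixed-product rule, tensor products of eigenvectors are eigenvectors for the
  products of the eigenvalues.\<close>

lemma spectral_decomp_kron:
  assumes A: "spectral_decomp A U d" "A \<in> carrier_mat n n"
    and B: "spectral_decomp B V e" "B \<in> carrier_mat m m"
  shows "spectral_decomp (kron A B) (kron U V) (\<lambda>i. d (i div m) * e (i mod m))"
proof (rule spectral_decompI)
  note a = spectral_decompD[OF A] and b = spectral_decompD[OF B]
  note a' = mat_adjoint_carrier[OF a(1)] and b' = mat_adjoint_carrier[OF b(1)]
  show "kron U V \<in> carrier_mat (n * m) (n * m)" by (rule kron_carrier[OF a(1) b(1)])
  show "mat_adjoint (kron U V) * kron U V = 1\<^sub>m (n * m)"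
    unfolding kron_adjoint[OF a(1) b(1)] kron_mult[OF a' b' a(1) b(1)] a(2) b(2) by (rule kron_one)
  let ?D = "mat_diag n (\<lambda>i. complex_of_real (d i))" and ?E = "mat_diag m (\<lambda>i. complex_of_real (e i))"
  have UD: "U * ?D \<in> carrier_mat n n" and VE: "V * ?E \<in> carrier_mat m m" using a(1) b(1) by auto
  have "mat_diag (n * m) (\<lambda>i. complex_of_real (d (i div m) * e (i mod m))) = kron ?D ?E"
    unfolding kron_mat_diag by simp
  then show "kron A B = kron U V * mat_diag (n * m) (\<lambda>i. complex_of_real (d (i div m) * e (i mod m))) *
    mat_adjoint (kron U V)"
    using a(3) b(3) by (simp add: kron_adjoint[OF a(1) b(1)]
      kron_mult[OF a(1) b(1) mat_diag_dim mat_diag_dim] kron_mult[OF UD VE a' b'])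
qed

section \<open>Transposes and inverses\<close>

lemma adjoint_transpose:
  fixes A :: "complex mat"
  assumes "A \<in> carrier_mat m n"
  shows "mat_adjoint (transpose_mat A) = transpose_mat (mat_adjoint A)"
proof (rule eq_matI)
  have t: "transpose_mat A \<in> carrier_mat n m" using assms by auto
  note c = mat_adjoint_carrier[OF assms] mat_adjoint_carrier[OF t]
  show "dim_row (mat_adjoint (transpose_mat A)) = dim_row (transpose_mat (mat_adjoint A))"
    "dim_col (mat_adjoint (transpose_mat A)) = dim_col (transpose_mat (mat_adjoint A))" using c by auto
  fix i j assume "i < dim_row (transpose_mat (mat_adjoint A))" "j < dim_col (transpose_mat (mat_adjoint A))"
  then have "i < m" "j < n" using c by auto
  then show "mat_adjoint (transpose_mat A) $$ (i, j) = transpose_mat (mat_adjoint A) $$ (i, j)"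
    using assms c by (auto simp: index_mat_adjoint[OF t] index_mat_adjoint[OF assms])
qed

text \<open>\<open>transpose_mat (mat_adjoint U)\<close> is the entrywise conjugate of
  \<open>U\<close>: conjugated eigenvectors belong to the transpose, with the same real
  eigenvalues.\<close>

lemma spectral_decomp_transpose:
  assumes A: "spectral_decomp A U d" "A \<in> carrier_mat n n"
  shows "spectral_decomp (transpose_mat A) (transpose_mat (mat_adjoint U)) d"
proof (rule spectral_decompI)
  note a = spectral_decompD[OF A]
  note a' = mat_adjoint_carrier[OF a(1)]
  let ?D = "mat_diag n (\<lambda>i. complex_of_real (d i))"
  have Dt: "transpose_mat ?D = ?D" by (rule eq_matI) (auto simp: mat_diag_def)
  have adj: "mat_adjoint (transpose_mat (mat_adjoint U)) = transpose_mat U"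
    using adjoint_transpose[OF a'] adjoint_adjoint[OF a(1)] by simp
  show "transpose_mat (mat_adjoint U) \<in> carrier_mat n n" using a' by auto
  show "mat_adjoint (transpose_mat (mat_adjoint U)) * transpose_mat (mat_adjoint U) = 1\<^sub>m n"
    unfolding adj transpose_mult[OF a' a(1), symmetric] a(2) by simp
  have UD: "U * ?D \<in> carrier_mat n n" using a(1) by auto
  have "transpose_mat A = transpose_mat (mat_adjoint U) * transpose_mat (U * ?D)"
    unfolding a(3) by (rule transpose_mult[OF UD a'])
  also have "transpose_mat (U * ?D) = ?D * transpose_mat U"
    using transpose_mult[OF a(1) mat_diag_dim] Dt by simp
  also have "transpose_mat (mat_adjoint U) * \<dots> =
    transpose_mat (mat_adjoint U) * ?D * mat_adjoint (transpose_mat (mat_adjoint U))"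
    unfolding adj using a(1) a' by (simp add: assoc_mult_mat[of _ n n _ n _ n])
  finally show "transpose_mat A =
    transpose_mat (mat_adjoint U) * ?D * mat_adjoint (transpose_mat (mat_adjoint U))" .
qed

text \<open>Inverting the eigenvalues gives an explicit inverse \<open>B\<close>. Its existence
  makes \<open>mat_inverse\<close> return a value, and uniqueness of inverses identifies that value
  with \<open>B\<close>.\<close>

lemma spectral_decomp_inverse:
  assumes A: "spectral_decomp A U d" "A \<in> carrier_mat n n" and d: "\<And>i. i < n \<Longrightarrow> d i \<noteq> 0"
  shows "spectral_decomp (the (mat_inverse A)) U (\<lambda>i. 1 / d i)"
proof -
  note a = spectral_decompD[OF A]
  define B where "B = U * mat_diag n (\<lambda>i. complex_of_real (1 / d i)) * mat_adjoint U"
  have B: "B \<in> carrier_mat n n" unfolding B_def by (rule conj_diag_carrier[OF a(1)])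
  have diag: "mat_diag n (\<lambda>i. complex_of_real (d i) * complex_of_real (1 / d i)) = 1\<^sub>m n"
    by (rule eq_matI) (auto simp: mat_diag_def d)
  have "A * B = 1\<^sub>m n"
    unfolding B_def a(3) conj_diag_mult[OF a(1,2)] diag
    using a(1) unitary_comm[OF a(1,2)] by simp
  then have AB: "A * B = 1\<^sub>m n" "B * A = 1\<^sub>m n"
    using mat_mult_left_right_inverse[OF A(2) B] by auto
  then have "A \<in> Units (ring_mat TYPE(complex) n ())"
    using A(2) B unfolding Units_def by (auto simp: ring_mat_def)
  then obtain C where C: "mat_inverse A = Some C" using mat_inverse(1)[OF A(2), of "()"] by (cases "mat_inverse A") auto
  then have "A * C = 1\<^sub>m n" "C \<in> carrier_mat n n" using mat_inverse(2)[OF A(2) C] by auto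
  then have "C = B * A * C" using AB by simp
  also have "\<dots> = B * (A * C)" by (rule assoc_mult_mat[OF B A(2) \<open>C \<in> carrier_mat n n\<close>])
  also have "\<dots> = B" using \<open>A * C = 1\<^sub>m n\<close> B by simp
  finally have "the (mat_inverse A) = B" using C by simp
  then show ?thesis using a unfolding B_def by (intro spectral_decompI) auto
qed

section \<open>The relative entropy as a double sum\<close>

text \<open>In the product eigenbasis, the vectorized square root of \<rho> has as coefficient at
  the pair \<open>(j, i)\<close> the overlap
  \<open>\<langle>j\<^sub>\<sigma>|i\<^sub>\<rho>\<rangle>\<close> times \<open>sqrt (p i)\<close>,
  and the matrix inside \<open>f\<close> has the eigenvalue \<open>q j / p i\<close>.\<close>

lemma quantum_f_relent_sum:
  assumes \<rho>: "spectral_decomp \<rho> U p" "\<rho> \<in> carrier_mat n n" "\<And>i. i < n \<Longrightarrow> p i > 0"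
    and \<sigma>: "spectral_decomp \<sigma> V q" "\<sigma> \<in> carrier_mat n n"
  shows "quantum_f_relent f \<rho> \<sigma> =
    (\<Sum>i<n. \<Sum>j<n. p i * (norm ((mat_adjoint V * U) $$ (j, i)))\<^sup>2 * f (q j / p i))"
proof -
  note r = spectral_decompD[OF \<rho>(1,2)] and s = spectral_decompD[OF \<sigma>]
  note r' = mat_adjoint_carrier[OF r(1)] and s' = mat_adjoint_carrier[OF s(1)]
  define W where "W = transpose_mat (mat_adjoint U)"
  define R where "R = herm_fun sqrt \<rho>"
  define G where "G = mat_adjoint V * U"
  have inv: "spectral_decomp (the (mat_inverse \<rho>)) U (\<lambda>i. 1 / p i)"
    using \<rho>(3) by (intro spectral_decomp_inverse[OF \<rho>(1,2)]) force
  then have invc: "the (mat_inverse \<rho>) \<in> carrier_mat n n"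
    using r(1) unfolding spectral_decomp_def by auto
  have W: "W \<in> carrier_mat n n" using r' unfolding W_def by auto
  have dW: "spectral_decomp (transpose_mat (the (mat_inverse \<rho>))) W (\<lambda>i. 1 / p i)"
    unfolding W_def by (rule spectral_decomp_transpose[OF inv invc])
  have tc: "transpose_mat (the (mat_inverse \<rho>)) \<in> carrier_mat n n" using invc by auto
  note K = kron_carrier[OF \<sigma>(2) tc] and VW = kron_carrier[OF s(1) W]
  note dK = spectral_decomp_kron[OF \<sigma> dW tc]
  have Rdef: "R = U * mat_diag n (\<lambda>i. complex_of_real (sqrt (p i))) * mat_adjoint U"
    unfolding R_def by (rule herm_fun_conj_diag[OF \<rho>(1,2)])
  have R: "R \<in> carrier_mat n n" unfolding Rdef by (rule conj_diag_carrier[OF r(1)])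
  have v: "vec_of_mat R \<in> carrier_vec (n * n)" using R unfolding vec_of_mat_def by auto
  \<comment> \<open>\<open>R\<close> scales the columns of \<open>U\<close> by
    \<open>sqrt (p i)\<close>; the coefficients sought are the entries of this product.\<close>
  have RU: "mat_adjoint V * (R * U) = G * mat_diag n (\<lambda>i. complex_of_real (sqrt (p i)))"
  proof -
    have UD: "U * mat_diag n (\<lambda>i. complex_of_real (sqrt (p i))) \<in> carrier_mat n n" using r(1) by auto
    have "R * U = U * mat_diag n (\<lambda>i. complex_of_real (sqrt (p i))) * (mat_adjoint U * U)"
      unfolding Rdef by (rule assoc_mult_mat[OF UD r' r(1)])
    also have "\<dots> = U * mat_diag n (\<lambda>i. complex_of_real (sqrt (p i)))"
      unfolding r(2) by (rule right_mult_one_mat[OF UD])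
    finally show ?thesis unfolding G_def using assoc_mult_mat[OF s' r(1) mat_diag_dim] by simp
  qed
  have G: "G \<in> carrier_mat n n" using r(1) s' unfolding G_def by auto
  have y: "(\<Sum>k<n * n. cnj (kron V W $$ (k, u)) * vec_index (vec_of_mat R) k) =
    complex_of_real (sqrt (p (u mod n))) * G $$ (u div n, u mod n)" if u: "u < n * n" for u
  proof -
    note dm = div_mod_less[OF u]
    have RUc: "R * U \<in> carrier_mat n n" using R r(1) by auto
    have "(\<Sum>k<n * n. cnj (kron V W $$ (k, u)) * vec_index (vec_of_mat R) k) =
      (\<Sum>k<n * n. cnj (V $$ (k div n, u div n)) * (R $$ (k div n, k mod n) * U $$ (k mod n, u mod n)))"
    proof (intro sum.cong refl)
      fix k assume "k \<in> {..<n * n}"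
      then have k: "k < n * n" by simp
      \<comment> \<open>The second tensor factor carries conjugated eigenvectors, so conjugating it
        restores \<open>U\<close> and the sum becomes an ordinary matrix product.\<close>
      have "W $$ (k mod n, u mod n) = cnj (U $$ (k mod n, u mod n))"
        unfolding W_def using r' div_mod_less[OF k] dm by (simp add: index_mat_adjoint[OF r(1)])
      then show "cnj (kron V W $$ (k, u)) * vec_index (vec_of_mat R) k =
        cnj (V $$ (k div n, u div n)) * (R $$ (k div n, k mod n) * U $$ (k mod n, u mod n))"
        unfolding index_kron[OF s(1) W k u] vec_of_mat_def using k R by simp
    qed
    also have "\<dots> = (\<Sum>a<n. \<Sum>b<n. cnj (V $$ (a, u div n)) * (R $$ (a, b) * U $$ (b, u mod n)))"
      by (rule sum_div_mod)
    also have "\<dots> = (\<Sum>a<n. mat_adjoint V $$ (u div n, a) * (R * U) $$ (a, u mod n))"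
      using dm by (intro sum.cong refl)
        (simp add: index_mat_adjoint[OF s(1)] index_mult_sum[OF R r(1)] sum_distrib_left del: index_mult_mat(1))
    also have "\<dots> = (mat_adjoint V * (R * U)) $$ (u div n, u mod n)"
      by (rule index_mult_sum[OF s' RUc dm, symmetric])
    also have "\<dots> = G $$ (u div n, u mod n) * complex_of_real (sqrt (p (u mod n)))"
      unfolding RU mat_diag_mult_right[OF G] using dm by simp
    finally show ?thesis by simp
  qed
  have "quantum_f_relent f \<rho> \<sigma> = (\<Sum>u<n * n. f (q (u div n) * (1 / p (u mod n))) *
    (norm (complex_of_real (sqrt (p (u mod n))) * G $$ (u div n, u mod n)))\<^sup>2)"
    unfolding quantum_f_relent_def Let_def R_def[symmetric] herm_fun_conj_diag[OF dK K]
      quadratic_form_conj_diag[OF VW v]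
    by (intro sum.cong refl) (simp add: y)
  also have "\<dots> = (\<Sum>j<n. \<Sum>i<n. f (q j * (1 / p i)) * (norm (complex_of_real (sqrt (p i)) * G $$ (j, i)))\<^sup>2)"
    by (rule sum_div_mod)
  also have "\<dots> = (\<Sum>i<n. \<Sum>j<n. f (q j * (1 / p i)) * (norm (complex_of_real (sqrt (p i)) * G $$ (j, i)))\<^sup>2)"
    by (rule sum.swap)
  also have "\<dots> = (\<Sum>i<n. \<Sum>j<n. p i * (norm (G $$ (j, i)))\<^sup>2 * f (q j / p i))"
    using \<rho>(3) by (intro sum.cong refl) (simp add: norm_mult power_mult_distrib less_imp_le)
  finally show ?thesis unfolding G_def .
qed

subsection \<open>Data processing for resolvents\<close>

lemma trace_unitary_conj:
  fixes U X :: "complex mat"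
  assumes U: "U \<in> carrier_mat n n" "mat_adjoint U * U = 1\<^sub>m n" and X: "X \<in> carrier_mat n n"
  shows "mat_trace (mat_adjoint U * X * U) = mat_trace X"
proof -
  note U' = mat_adjoint_carrier[OF U(1)]
  have "mat_trace (mat_adjoint U * X * U) = mat_trace (U * (mat_adjoint U * X))"
    using U(1) U' X by (intro trace_mult_commute[of _ n n]) auto
  also have "U * (mat_adjoint U * X) = U * mat_adjoint U * X"
    by (rule assoc_mult_mat[OF U(1) U' X, symmetric])
  finally show ?thesis using X by (simp add: unitary_comm[OF U])
qed

lemma trace_adjoint_mult_diag:
  fixes A B :: "complex mat"
  assumes A: "A \<in> carrier_mat m n" and B: "B \<in> carrier_mat m n"
  shows "mat_trace (mat_adjoint A * B * mat_diag n d) = (\<Sum>i<n. \<Sum>j<m. cnj (A $$ (j, i)) * B $$ (j, i) * d i)"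
proof -
  note A' = mat_adjoint_carrier[OF A]
  have AB: "mat_adjoint A * B \<in> carrier_mat n n" using A' B by auto
  show ?thesis
    unfolding mat_diag_mult_right[OF AB] mat_trace_def
    by (simp add: index_mult_sum[OF A' B] index_mat_adjoint[OF A] sum_distrib_right del: index_mult_mat(1))
qed

text \<open>\<rho> and \<sigma> enter linearly, each multiplied by a polynomial in \<open>Y\<close>
  and its adjoint; this makes the functional compatible with the partial trace.\<close>

definition resolvent_form :: "real \<Rightarrow> real \<Rightarrow> complex mat \<Rightarrow> complex mat \<Rightarrow> complex mat \<Rightarrow> real" where
  "resolvent_form c1 c2 \<rho> \<sigma> Y =
     2 * Re (mat_trace (mat_adjoint Y * \<rho>)) - c1 * Re (mat_trace (mat_adjoint Y * Y * \<rho>)) -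
     c2 * Re (mat_trace (Y * mat_adjoint Y * \<sigma>))"

text \<open>\<open>Z\<close> is \<open>Y\<close> written in the eigenbases of \<sigma> (rows) and
  \<rho> (columns). In these coordinates the functional decouples into one scalar quadratic for each
  entry of \<open>Z\<close>.\<close>

lemma resolvent_form_sum:
  assumes \<rho>: "spectral_decomp \<rho> U p" "\<rho> \<in> carrier_mat n n"
    and \<sigma>: "spectral_decomp \<sigma> V q" "\<sigma> \<in> carrier_mat n n"
    and Y: "Y \<in> carrier_mat n n"
  defines "G \<equiv> mat_adjoint V * U" and "Z \<equiv> mat_adjoint V * Y * U"
  shows "resolvent_form c1 c2 \<rho> \<sigma> Y =
    (\<Sum>i<n. \<Sum>j<n. 2 * p i * Re (cnj (Z $$ (j, i)) * G $$ (j, i)) - (c1 * p i + c2 * q j) * (norm (Z $$ (j, i)))\<^sup>2)"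
proof -
  note r = spectral_decompD[OF \<rho>] and s = spectral_decompD[OF \<sigma>]
  note r' = mat_adjoint_carrier[OF r(1)] and s' = mat_adjoint_carrier[OF s(1)] and Y' = mat_adjoint_carrier[OF Y]
  note sq = assoc_mult_mat[of _ n n _ n _ n] mult_carrier_mat[of _ n n _ n]
  let ?P = "mat_diag n (\<lambda>i. complex_of_real (p i))" and ?Q = "mat_diag n (\<lambda>i. complex_of_real (q i))"
  have VY: "mat_adjoint V * Y \<in> carrier_mat n n" using s' Y by auto
  have Zc: "Z \<in> carrier_mat n n" unfolding Z_def using VY r(1) by auto
  note Z'c = mat_adjoint_carrier[OF Zc]
  have Gc: "G \<in> carrier_mat n n" unfolding G_def using s' r(1) by auto
  have Z': "mat_adjoint Z = mat_adjoint U * mat_adjoint Y * V"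
    unfolding Z_def adjoint_mult[OF VY r(1)] adjoint_mult[OF s' Y] adjoint_adjoint[OF s(1)]
    using r' Y' s(1) by (simp add: sq)
  have cancelU: "mat_adjoint U * (U * X) = X" if "X \<in> carrier_mat n n" for X
    using assoc_mult_mat[OF r' r(1) that] that by (simp add: r(2))
  have cancelV: "mat_adjoint V * (V * X) = X" if "X \<in> carrier_mat n n" for X
    using assoc_mult_mat[OF s' s(1) that] that by (simp add: s(2))
  have cancelU': "U * (mat_adjoint U * X) = X" if "X \<in> carrier_mat n n" for X
    using assoc_mult_mat[OF r(1) r' that] that by (simp add: unitary_comm[OF r(1,2)])
  have cancelV': "V * (mat_adjoint V * X) = X" if "X \<in> carrier_mat n n" for X
    using assoc_mult_mat[OF s(1) s' that] that by (simp add: unitary_comm[OF s(1,2)])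
  note carr = r(1) s(1) r' s' Y Y' mat_diag_dim
  \<comment> \<open>The two traces with \<rho> are conjugated by \<open>U\<close> and the one with
    \<sigma> by \<open>V\<close>, so that the respective matrix becomes diagonal.\<close>
  have "mat_trace (mat_adjoint Y * \<rho>) = mat_trace (mat_adjoint U * (mat_adjoint Y * \<rho>) * U)"
    using Y' \<rho>(2) by (intro trace_unitary_conj[OF r(1,2), symmetric]) auto
  also have "mat_adjoint U * (mat_adjoint Y * \<rho>) * U = mat_adjoint Z * G * ?P"
    unfolding Z' G_def r(3) using carr by (simp add: sq cancelU cancelV' r(2) right_mult_one_mat[of _ n n])
  finally have t1: "mat_trace (mat_adjoint Y * \<rho>) = (\<Sum>i<n. \<Sum>j<n. cnj (Z $$ (j, i)) * G $$ (j, i) * p i)"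
    by (simp add: trace_adjoint_mult_diag[OF Zc Gc])
  have "mat_trace (mat_adjoint Y * Y * \<rho>) = mat_trace (mat_adjoint U * (mat_adjoint Y * Y * \<rho>) * U)"
    using Y Y' \<rho>(2) by (intro trace_unitary_conj[OF r(1,2), symmetric] mult_carrier_mat[of _ n n _ n]) auto
  also have "mat_adjoint U * (mat_adjoint Y * Y * \<rho>) * U = mat_adjoint Z * Z * ?P"
    unfolding Z' unfolding Z_def r(3) using carr by (simp add: sq cancelU cancelV' r(2) right_mult_one_mat[of _ n n])
  finally have t2: "mat_trace (mat_adjoint Y * Y * \<rho>) = (\<Sum>i<n. \<Sum>j<n. cnj (Z $$ (j, i)) * Z $$ (j, i) * p i)"
    by (simp add: trace_adjoint_mult_diag[OF Zc Zc])
  have "mat_trace (Y * mat_adjoint Y * \<sigma>) = mat_trace (mat_adjoint V * (Y * mat_adjoint Y * \<sigma>) * V)"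
    using Y Y' \<sigma>(2) by (intro trace_unitary_conj[OF s(1,2), symmetric] mult_carrier_mat[of _ n n _ n]) auto
  also have "mat_adjoint V * (Y * mat_adjoint Y * \<sigma>) * V = Z * mat_adjoint Z * ?Q"
    unfolding Z' unfolding Z_def s(3) using carr by (simp add: sq cancelV cancelU' s(2) right_mult_one_mat[of _ n n])
  \<comment> \<open>Writing \<open>Z\<close> as a double adjoint gives the shape of
    \<open>trace_adjoint_mult_diag\<close>, with rows and columns exchanged.\<close>
  also have "\<dots> = mat_adjoint (mat_adjoint Z) * mat_adjoint Z * ?Q"
    by (simp add: adjoint_adjoint[OF Zc])
  also have "mat_trace \<dots> = (\<Sum>j<n. \<Sum>i<n. cnj (mat_adjoint Z $$ (i, j)) * mat_adjoint Z $$ (i, j) * q j)"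
    by (rule trace_adjoint_mult_diag[OF Z'c Z'c])
  also have "\<dots> = (\<Sum>j<n. \<Sum>i<n. cnj (Z $$ (j, i)) * Z $$ (j, i) * q j)"
    by (intro sum.cong refl) (simp add: index_mat_adjoint[OF Zc])
  also have "\<dots> = (\<Sum>i<n. \<Sum>j<n. cnj (Z $$ (j, i)) * Z $$ (j, i) * q j)"
    by (rule sum.swap)
  finally have t3: "mat_trace (Y * mat_adjoint Y * \<sigma>) = (\<Sum>i<n. \<Sum>j<n. cnj (Z $$ (j, i)) * Z $$ (j, i) * q j)" .
  have sqn: "Re (cnj z * z * complex_of_real x) = (norm z)\<^sup>2 * x" for z x
    unfolding cmod_power2 by (simp add: power2_eq_square algebra_simps)
  show ?thesis
    unfolding resolvent_form_def t1 t2 t3 Re_sum sqn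
    unfolding sum_distrib_left sum_subtractf[symmetric]
    by (intro sum.cong refl) (simp add: algebra_simps)
qed

text \<open>The real part is at most the modulus \<open>norm z * norm g\<close>; what remains is the
  square of \<open>m * norm z - p * norm g\<close>.\<close>

lemma completed_square_le:
  fixes z g :: complex and p m :: real
  assumes "p \<ge> 0" "m > 0"
  shows "2 * p * Re (cnj z * g) - m * (norm z)\<^sup>2 \<le> p\<^sup>2 * (norm g)\<^sup>2 / m"
proof -
  have "Re (cnj z * g) \<le> norm z * norm g"
    using complex_Re_le_cmod[of "cnj z * g"] by (simp add: norm_mult)
  then have "2 * p * Re (cnj z * g) \<le> 2 * p * (norm z * norm g)"
    using assms by (intro mult_left_mono) auto
  moreover have "2 * p * (norm z * norm g) - m * (norm z)\<^sup>2 \<le> p\<^sup>2 * (norm g)\<^sup>2 / m"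
  proof -
    have "0 \<le> (m * norm z - p * norm g)\<^sup>2" by simp
    then show ?thesis using assms by (simp add: field_simps power2_eq_square)
  qed
  ultimately show ?thesis by linarith
qed

text \<open>The double sum of the relative entropy for the function \<open>1 / (c1 + c2 * r)\<close>
  with the inner quotient \<open>q j / p i\<close> cleared, which is the form in which the completed
  squares produce it.\<close>

definition resolvent_sum ::
  "real \<Rightarrow> real \<Rightarrow> nat \<Rightarrow> complex mat \<Rightarrow> (nat \<Rightarrow> real) \<Rightarrow> complex mat \<Rightarrow> (nat \<Rightarrow> real) \<Rightarrow> real" where
  "resolvent_sum c1 c2 n U p V q =
    (\<Sum>i<n. \<Sum>j<n. (p i)\<^sup>2 * (norm ((mat_adjoint V * U) $$ (j, i)))\<^sup>2 / (c1 * p i + c2 * q j))"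

lemma resolvent_form_le:
  assumes "spectral_decomp \<rho> U p" "\<rho> \<in> carrier_mat n n" "spectral_decomp \<sigma> V q" "\<sigma> \<in> carrier_mat n n"
    and "Y \<in> carrier_mat n n"
    and "\<And>i. i < n \<Longrightarrow> p i > 0" "\<And>i j. i < n \<Longrightarrow> j < n \<Longrightarrow> c1 * p i + c2 * q j > 0"
  shows "resolvent_form c1 c2 \<rho> \<sigma> Y \<le> resolvent_sum c1 c2 n U p V q"
  unfolding resolvent_form_sum[OF assms(1-5)] resolvent_sum_def
  by (intro sum_mono completed_square_le) (auto simp: assms less_imp_le)

text \<open>The scalar quadratics can be maximized independently, because every matrix
  \<open>Z\<close> arises from some \<open>Y\<close> by the unitary change of bases.\<close>

lemma resolvent_form_attained:
  assumes \<rho>: "spectral_decomp \<rho> U p" "\<rho> \<in> carrier_mat n n"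
    and \<sigma>: "spectral_decomp \<sigma> V q" "\<sigma> \<in> carrier_mat n n"
    and pos: "\<And>i j. i < n \<Longrightarrow> j < n \<Longrightarrow> c1 * p i + c2 * q j > 0"
  obtains Y where "Y \<in> carrier_mat n n" "resolvent_form c1 c2 \<rho> \<sigma> Y = resolvent_sum c1 c2 n U p V q"
proof -
  note r = spectral_decompD[OF \<rho>] and s = spectral_decompD[OF \<sigma>]
  note r' = mat_adjoint_carrier[OF r(1)] and s' = mat_adjoint_carrier[OF s(1)]
  note sq = assoc_mult_mat[of _ n n _ n _ n] mult_carrier_mat[of _ n n _ n]
  define G where "G = mat_adjoint V * U"
  \<comment> \<open>Each entry is the maximizer \<open>p i * g / m\<close> of its quadratic, with
    \<open>g\<close> the overlap and \<open>m = c1 * p i + c2 * q j\<close>.\<close>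
  define Z where "Z = Matrix.mat n n (\<lambda>(j, i). complex_of_real (p i / (c1 * p i + c2 * q j)) * G $$ (j, i))"
  define Y where "Y = V * Z * mat_adjoint U"
  have Zc: "Z \<in> carrier_mat n n" unfolding Z_def by auto
  have Yc: "Y \<in> carrier_mat n n" unfolding Y_def using Zc s(1) r' by (auto intro!: mult_carrier_mat[of _ n n _ n])
  have ZU: "Z * (mat_adjoint U * U) = Z" and VVZ: "mat_adjoint V * (V * Z) = Z"
    using assoc_mult_mat[OF s' s(1) Zc] Zc r(2) s(2) by auto
  have ZY: "mat_adjoint V * Y * U = Z"
    unfolding Y_def using Zc s(1) s' r(1) r' by (simp add: sq ZU VVZ)
  have *: "2 * p i * Re (cnj (Z $$ (j, i)) * G $$ (j, i)) - (c1 * p i + c2 * q j) * (norm (Z $$ (j, i)))\<^sup>2 =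
    (p i)\<^sup>2 * (norm (G $$ (j, i)))\<^sup>2 / (c1 * p i + c2 * q j)" if "i < n" "j < n" for i j
  proof -
    define m where "m = c1 * p i + c2 * q j"
    have m: "m > 0" using pos[OF that] unfolding m_def .
    have z: "Z $$ (j, i) = complex_of_real (p i / m) * G $$ (j, i)"
      unfolding Z_def m_def using that by simp
    have e1: "Re (cnj (Z $$ (j, i)) * G $$ (j, i)) = p i / m * (norm (G $$ (j, i)))\<^sup>2"
      unfolding z cmod_power2 by (simp add: power2_eq_square algebra_simps add_divide_distrib)
    have e2: "(norm (Z $$ (j, i)))\<^sup>2 = (p i / m)\<^sup>2 * (norm (G $$ (j, i)))\<^sup>2"
      unfolding z norm_mult power_mult_distrib norm_of_real by (simp add: power_divide)
    show ?thesis
      using m unfolding m_def[symmetric] e1 e2 by (simp add: field_simps power2_eq_square)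
  qed
  have "resolvent_form c1 c2 \<rho> \<sigma> Y = resolvent_sum c1 c2 n U p V q"
    unfolding resolvent_form_sum[OF \<rho> \<sigma> Yc] resolvent_sum_def ZY G_def[symmetric]
    by (intro sum.cong refl, rule *) auto
  then show ?thesis using that Yc by blast
qed

section \<open>The partial trace\<close>

lemma partial_trace_carrier: "partial_trace_B dA dB M \<in> carrier_mat dA dA"
  unfolding partial_trace_B_def by simp

lemma index_pair_less:
  fixes a k :: nat
  assumes "a < m" "k < n"
  shows "a * n + k < m * n"
proof -
  have "a * n + k < Suc a * n" using assms by simp
  also have "\<dots> \<le> m * n" using assms by (intro mult_le_mono1) simp
  finally show ?thesis .
qed

text \<open>Duality between the partial trace and \<open>X \<mapsto> kron X (1\<^sub>m dB)\<close>
  under the trace pairing: the identity factor forces the second components to agree.\<close>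

lemma trace_kron_one:
  fixes X M :: "complex mat"
  assumes X: "X \<in> carrier_mat dA dA" and M: "M \<in> carrier_mat (dA * dB) (dA * dB)"
  shows "mat_trace (kron X (1\<^sub>m dB) * M) = mat_trace (X * partial_trace_B dA dB M)"
proof -
  have one: "(1\<^sub>m dB :: complex mat) \<in> carrier_mat dB dB" by simp
  have "mat_trace (kron X (1\<^sub>m dB) * M) =
    (\<Sum>u<dA * dB. \<Sum>w<dA * dB. X $$ (u div dB, w div dB) * (if u mod dB = w mod dB then 1 else 0) *
      M $$ (w div dB * dB + w mod dB, u div dB * dB + u mod dB))"
    unfolding trace_mult[OF kron_carrier[OF X one] M]
    by (intro sum.cong refl) (simp add: index_kron[OF X one] div_mod_less)
  also have "\<dots> = (\<Sum>a<dA. \<Sum>k<dB. \<Sum>w<dA * dB. X $$ (a, w div dB) * (if k = w mod dB then 1 else 0) *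
      M $$ (w div dB * dB + w mod dB, a * dB + k))"
    by (rule sum_div_mod)
  also have "\<dots> = (\<Sum>a<dA. \<Sum>k<dB. \<Sum>b<dA. \<Sum>l<dB. X $$ (a, b) * (if k = l then 1 else 0) *
      M $$ (b * dB + l, a * dB + k))"
    by (intro sum.cong refl sum_div_mod)
  also have "\<dots> = (\<Sum>a<dA. \<Sum>k<dB. \<Sum>b<dA. X $$ (a, b) * M $$ (b * dB + k, a * dB + k))"
  proof (intro sum.cong refl)
    fix a k b assume "k \<in> {..<dB}"
    have "(\<Sum>l<dB. X $$ (a, b) * (if k = l then 1 else 0) * M $$ (b * dB + l, a * dB + k)) =
      (\<Sum>l<dB. if k = l then X $$ (a, b) * M $$ (b * dB + l, a * dB + k) else 0)"
      by (intro sum.cong refl) simp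
    also have "\<dots> = X $$ (a, b) * M $$ (b * dB + k, a * dB + k)"
      using \<open>k \<in> {..<dB}\<close> by simp
    finally show "(\<Sum>l<dB. X $$ (a, b) * (if k = l then 1 else 0) * M $$ (b * dB + l, a * dB + k)) =
      X $$ (a, b) * M $$ (b * dB + k, a * dB + k)" .
  qed
  also have "\<dots> = (\<Sum>a<dA. \<Sum>b<dA. \<Sum>k<dB. X $$ (a, b) * M $$ (b * dB + k, a * dB + k))"
    by (intro sum.cong refl sum.swap)
  also have "\<dots> = mat_trace (X * partial_trace_B dA dB M)"
    unfolding trace_mult[OF X partial_trace_carrier]
    by (intro sum.cong refl) (simp add: partial_trace_B_def sum_distrib_left)
  finally show ?thesis .
qed

lemma trace_partial_trace:
  fixes M :: "complex mat"
  assumes "M \<in> carrier_mat (dA * dB) (dA * dB)"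
  shows "mat_trace (partial_trace_B dA dB M) = mat_trace M"
  using trace_kron_one[OF one_carrier_mat assms] assms partial_trace_carrier[of dA dB M]
  by (simp add: kron_one)

text \<open>Tensoring with the identity respects products and adjoints, so duality applies to each
  of the three traces.\<close>

lemma resolvent_form_partial_trace:
  assumes Y: "Y \<in> carrier_mat dA dA"
    and \<rho>: "\<rho> \<in> carrier_mat (dA * dB) (dA * dB)" and \<sigma>: "\<sigma> \<in> carrier_mat (dA * dB) (dA * dB)"
  shows "resolvent_form c1 c2 \<rho> \<sigma> (kron Y (1\<^sub>m dB)) =
    resolvent_form c1 c2 (partial_trace_B dA dB \<rho>) (partial_trace_B dA dB \<sigma>) Y"
proof -
  have one: "(1\<^sub>m dB :: complex mat) \<in> carrier_mat dB dB" by simp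
  note Y' = mat_adjoint_carrier[OF Y]
  have one': "mat_adjoint (1\<^sub>m dB :: complex mat) = 1\<^sub>m dB"
    using adjoint_mat_diag[of dB "\<lambda>_. 1"] by simp
  have YY: "mat_adjoint Y * Y \<in> carrier_mat dA dA" "Y * mat_adjoint Y \<in> carrier_mat dA dA"
    using Y Y' by auto
  show ?thesis
    unfolding resolvent_form_def kron_adjoint[OF Y one] one' kron_mult[OF Y' one Y one] kron_mult[OF Y one Y' one]
    by (simp add: trace_kron_one[OF Y' \<rho>] trace_kron_one[OF YY(1) \<rho>] trace_kron_one[OF YY(2) \<sigma>])
qed

lemma quadratic_form_sum:
  fixes M :: "complex mat"
  assumes M: "M \<in> carrier_mat n n" and v: "v \<in> carrier_vec n"
  shows "(M *\<^sub>v v) \<bullet>c v = (\<Sum>i<n. \<Sum>j<n. M $$ (i, j) * vec_index v j * cnj (vec_index v i))"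
proof -
  have "(M *\<^sub>v v) \<bullet>c v = (\<Sum>i<n. vec_index (M *\<^sub>v v) i * cnj (vec_index v i))"
    using v by (auto simp: scalar_prod_def atLeast0LessThan simp del: index_mult_mat_vec intro!: sum.cong)
  also have "\<dots> = (\<Sum>i<n. \<Sum>j<n. M $$ (i, j) * vec_index v j * cnj (vec_index v i))"
    by (intro sum.cong refl) (simp add: index_mult_mat_vec_sum[OF M v] sum_distrib_right del: index_mult_mat_vec)
  finally show ?thesis .
qed

text \<open>The form of the partial trace at \<open>v\<close> is the sum over \<open>k\<close> of
  the forms of \<open>M\<close> at \<open>w k\<close>, that is, at \<open>v\<close> tensored with
  the \<open>k\<close>-th basis vector. The condition \<open>0 < dB\<close> keeps this sum
  nonempty.\<close>

lemma strictly_positive_partial_trace: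
  assumes M: "strictly_positive_mat (dA * dB) M" and dB: "0 < dB"
  shows "strictly_positive_mat dA (partial_trace_B dA dB M)"
proof -
  let ?T = "partial_trace_B dA dB M"
  note T = partial_trace_carrier[of dA dB M]
  have Mc: "M \<in> carrier_mat (dA * dB) (dA * dB)" and MM: "mat_adjoint M = M"
    using M by (auto simp: strictly_positive_mat_def hermitian_mat_def)
  have h: "hermitian_mat dA ?T"
    unfolding hermitian_mat_def
  proof (intro conjI T eq_matI)
    fix i j assume "i < dim_row ?T" "j < dim_col ?T"
    then have ij: "i < dA" "j < dA" using T by auto
    have "M $$ (i * dB + k, j * dB + k) = cnj (M $$ (j * dB + k, i * dB + k))" if "k < dB" for k
      using index_mat_adjoint[OF Mc index_pair_less[OF ij(1) that] index_pair_less[OF ij(2) that]] MM by simp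
    then show "mat_adjoint ?T $$ (i, j) = ?T $$ (i, j)"
      unfolding index_mat_adjoint[OF T ij] unfolding partial_trace_B_def using ij by simp
  qed (use T mat_adjoint_carrier[OF T] in auto)
  have "Re ((?T *\<^sub>v v) \<bullet>c v) > 0" if v: "v \<in> carrier_vec dA" "v \<noteq> 0\<^sub>v dA" for v
  proof -
    define w where "w k = Matrix.vec (dA * dB) (\<lambda>i. if i mod dB = k then vec_index v (i div dB) else 0)" for k
    have w: "w k \<in> carrier_vec (dA * dB)" for k unfolding w_def by simp
    obtain a where a: "a < dA" "vec_index v a \<noteq> 0"
      using v by (metis carrier_vecD eq_vecI index_zero_vec)
    have wk: "vec_index (w k) (b * dB + l) = (if l = k then vec_index v b else 0)"
      if "b < dA" "l < dB" for b l k
      unfolding w_def using index_pair_less[OF that] that by simp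
    have wpos: "Re ((M *\<^sub>v w k) \<bullet>c w k) > 0" if "k < dB" for k
    proof -
      have "w k \<noteq> 0\<^sub>v (dA * dB)"
        using wk[OF a(1) that, of k] index_pair_less[OF a(1) that] a(2) by auto
      then show ?thesis using M w unfolding strictly_positive_mat_def by blast
    qed
    have split: "(\<Sum>i<dA * dB. F i) = (\<Sum>b<dA. \<Sum>l<dB. F (b * dB + l))" for F :: "nat \<Rightarrow> complex"
      using sum_div_mod[of "\<lambda>b l. F (b * dB + l)" dB dA] by simp
    have Mw: "(M *\<^sub>v w k) \<bullet>c w k =
      (\<Sum>i<dA. \<Sum>j<dA. M $$ (i * dB + k, j * dB + k) * vec_index v j * cnj (vec_index v i))" if k: "k < dB" for k
    proof -
      have "(M *\<^sub>v w k) \<bullet>c w k = (\<Sum>i<dA. \<Sum>l<dB. \<Sum>j<dA. \<Sum>l'<dB.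
        M $$ (i * dB + l, j * dB + l') * vec_index (w k) (j * dB + l') * cnj (vec_index (w k) (i * dB + l)))"
        unfolding quadratic_form_sum[OF Mc w] split ..
      \<comment> \<open>Only entries whose two second components equal \<open>k\<close> survive, and
        these are the ones collected by the partial trace.\<close>
      also have "\<dots> = (\<Sum>i<dA. \<Sum>l<dB. \<Sum>j<dA. \<Sum>l'<dB. if l' = k then (if l = k then
        M $$ (i * dB + k, j * dB + k) * vec_index v j * cnj (vec_index v i) else 0) else 0)"
        by (intro sum.cong refl) (simp add: wk)
      also have "\<dots> = (\<Sum>i<dA. \<Sum>l<dB. \<Sum>j<dA. if l = k then
        M $$ (i * dB + k, j * dB + k) * vec_index v j * cnj (vec_index v i) else 0)"
        using k by (intro sum.cong refl) (simp add: sum.delta)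
      also have "\<dots> = (\<Sum>i<dA. \<Sum>j<dA. \<Sum>l<dB. if l = k then
        M $$ (i * dB + k, j * dB + k) * vec_index v j * cnj (vec_index v i) else 0)"
        by (intro sum.cong refl sum.swap)
      also have "\<dots> = (\<Sum>i<dA. \<Sum>j<dA. M $$ (i * dB + k, j * dB + k) * vec_index v j * cnj (vec_index v i))"
        using k by (intro sum.cong refl) (simp add: sum.delta)
      finally show ?thesis .
    qed
    have "(?T *\<^sub>v v) \<bullet>c v = (\<Sum>i<dA. \<Sum>j<dA. \<Sum>k<dB.
      M $$ (i * dB + k, j * dB + k) * vec_index v j * cnj (vec_index v i))"
      unfolding quadratic_form_sum[OF T v(1)]
      by (intro sum.cong refl) (simp add: partial_trace_B_def sum_distrib_right)
    also have "\<dots> = (\<Sum>i<dA. \<Sum>k<dB. \<Sum>j<dA. 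
      M $$ (i * dB + k, j * dB + k) * vec_index v j * cnj (vec_index v i))"
      by (intro sum.cong refl sum.swap)
    also have "\<dots> = (\<Sum>k<dB. \<Sum>i<dA. \<Sum>j<dA. 
      M $$ (i * dB + k, j * dB + k) * vec_index v j * cnj (vec_index v i))"
      by (rule sum.swap)
    also have "\<dots> = (\<Sum>k<dB. (M *\<^sub>v w k) \<bullet>c w k)"
      by (intro sum.cong refl) (simp add: Mw)
    finally have "Re ((?T *\<^sub>v v) \<bullet>c v) = (\<Sum>k<dB. Re ((M *\<^sub>v w k) \<bullet>c w k))" by simp
    also have "\<dots> > 0" using dB by (intro sum_pos) (auto simp: wpos)
    finally show ?thesis .
  qed
  then show ?thesis using h unfolding strictly_positive_mat_def by blast
qed

subsection \<open>Finite measures on the ratios\<close>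

text \<open>Indices with the same ratio are merged, which turns a weighted family into a measure
  with distinct atoms.\<close>

lemma sum_scaleR_image_gen:
  fixes w r :: "'k \<Rightarrow> real" and \<phi> :: "real \<Rightarrow> 'a :: real_vector"
  assumes "finite K"
  shows "(\<Sum>k\<in>K. w k *\<^sub>R \<phi> (r k)) = (\<Sum>t\<in>r ` K. (\<Sum>k | k \<in> K \<and> r k = t. w k) *\<^sub>R \<phi> t)"
proof -
  have "(\<Sum>k\<in>K. w k *\<^sub>R \<phi> (r k)) = (\<Sum>t\<in>r ` K. \<Sum>k | k \<in> K \<and> r k = t. w k *\<^sub>R \<phi> (r k))"
    by (rule sum.image_gen[OF assms])
  also have "\<dots> = (\<Sum>t\<in>r ` K. (\<Sum>k | k \<in> K \<and> r k = t. w k) *\<^sub>R \<phi> t)"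
    by (intro sum.cong refl) (simp add: scaleR_sum_left)
  finally show ?thesis .
qed

text \<open>Vanishing moments make every polynomial integrate to zero, and a polynomial vanishing at
  all atoms but \<open>t\<close> isolates the weight \<open>m t\<close>.\<close>

lemma moments_zero_imp_zero:
  fixes m :: "real \<Rightarrow> real"
  assumes T: "finite T" and mom: "\<And>n. (\<Sum>t\<in>T. m t * t ^ n) = 0" and t: "t \<in> T"
  shows "m t = 0"
proof -
  have poly: "(\<Sum>s\<in>T. m s * poly P s) = 0" for P
  proof -
    have "(\<Sum>s\<in>T. m s * poly P s) = (\<Sum>i\<le>degree P. coeff P i * (\<Sum>s\<in>T. m s * s ^ i))"
      unfolding poly_altdef sum_distrib_left by (subst sum.swap) (simp add: algebra_simps)
    then show ?thesis by (simp add: mom)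
  qed
  define P where "P = (\<Prod>s\<in>T - {t}. [:- s, 1:])"
  have "poly P s = 0" if "s \<in> T - {t}" for s
    unfolding P_def poly_prod using that T by (intro prod_zero) auto
  then have "(\<Sum>s\<in>T. m s * poly P s) = m t * poly P t"
    using T t by (simp add: sum.remove)
  moreover have "poly P t \<noteq> 0" unfolding P_def poly_prod using T by simp
  ultimately show ?thesis using poly[of P] by simp
qed

text \<open>Clearing denominators gives a polynomial in \<open>x\<close> with infinitely many roots,
  hence the zero polynomial. Its value at the pole \<open>a\<^sup>2 / (t - t0)\<close> of a single
  term isolates the weight \<open>m t\<close>.\<close>

lemma partial_fractions_zero_imp_zero:
  fixes m :: "real \<Rightarrow> real"
  assumes T: "finite T" and X: "infinite X" and a: "a \<noteq> 0"
    and nz: "\<And>x s. x \<in> X \<Longrightarrow> s \<in> T \<Longrightarrow> a\<^sup>2 - (s - t0) * x \<noteq> 0"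
    and zero: "\<And>x. x \<in> X \<Longrightarrow> (\<Sum>s\<in>T. m s * ((s - t0)\<^sup>2 / (a\<^sup>2 - (s - t0) * x))) = 0"
    and t: "t \<in> T" "t \<noteq> t0"
  shows "m t = 0"
proof -
  define Q where "Q s = (\<Prod>s'\<in>T - {s}. [:a\<^sup>2, - (s' - t0):])" for s
  define P where "P = (\<Sum>s\<in>T. Polynomial.smult (m s * (s - t0)\<^sup>2) (Q s))"
  have polyQ: "poly (Q s) x = (\<Prod>s'\<in>T - {s}. a\<^sup>2 - (s' - t0) * x)" for s x
    unfolding Q_def poly_prod by (simp add: algebra_simps)
  have "poly P x = 0" if x: "x \<in> X" for x
  proof -
    have "poly P x = (\<Sum>s\<in>T. m s * (s - t0)\<^sup>2 * (\<Prod>s'\<in>T - {s}. a\<^sup>2 - (s' - t0) * x))"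
      unfolding P_def poly_sum by (simp add: polyQ)
    also have "\<dots> = (\<Sum>s\<in>T. (\<Prod>s'\<in>T. a\<^sup>2 - (s' - t0) * x) * (m s * ((s - t0)\<^sup>2 / (a\<^sup>2 - (s - t0) * x))))"
      using T nz[OF x] by (intro sum.cong refl) (simp add: prod.remove)
    also have "\<dots> = 0" unfolding sum_distrib_left[symmetric] zero[OF x] by simp
    finally show ?thesis .
  qed
  then have "infinite {x. poly P x = 0}" using X infinite_super[of X "{x. poly P x = 0}"] by blast
  then have P0: "P = 0" using poly_roots_finite by blast
  define x where "x = a\<^sup>2 / (t - t0)"
  have "poly (Q s) x = 0" if "s \<in> T - {t}" for s
    unfolding polyQ x_def using that T t by (intro prod_zero bexI[of _ t]) auto
  then have "poly P x = m t * (t - t0)\<^sup>2 * poly (Q t) x"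
    unfolding P_def poly_sum using T t by (simp add: sum.remove)
  \<comment> \<open>Different atoms have different poles, so none of the remaining factors vanishes
    at \<open>x\<close>.\<close>
  moreover have "poly (Q t) x \<noteq> 0"
    unfolding polyQ x_def using T t a by (simp add: field_simps)
  ultimately show ?thesis using P0 t by simp
qed

section \<open>The kernel of the integral representation\<close>

text \<open>The positive lower bound does not depend on \<open>x\<close>, so for fixed
  \<open>t\<close> the kernel is bounded on \<open>{-a..a}\<close>.\<close>

lemma denominator_pos:
  fixes a t0 t x :: real
  assumes "a > 0" "t \<in> {t0 - a<..<t0 + a}" "x \<in> {-a..a}"
  shows "0 < a\<^sup>2 - \<bar>t - t0\<bar> * a" "a\<^sup>2 - \<bar>t - t0\<bar> * a \<le> a\<^sup>2 - (t - t0) * x"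
proof -
  have s: "\<bar>t - t0\<bar> < a" using assms by auto
  then show "0 < a\<^sup>2 - \<bar>t - t0\<bar> * a" using assms by (simp add: power2_eq_square)
  have "(t - t0) * x \<le> \<bar>t - t0\<bar> * \<bar>x\<bar>" by (metis abs_ge_self abs_mult)
  also have "\<dots> \<le> \<bar>t - t0\<bar> * a" using assms by (intro mult_left_mono) auto
  finally show "a\<^sup>2 - \<bar>t - t0\<bar> * a \<le> a\<^sup>2 - (t - t0) * x" by simp
qed

lemma kernel_set_integrable:
  fixes p :: "real \<Rightarrow> real"
  assumes a: "a > 0" "t \<in> {t0 - a<..<t0 + a}" and p: "set_integrable lborel {-a..a} p"
  shows "set_integrable lborel {-a..a} (\<lambda>x. (t - t0)\<^sup>2 / (a\<^sup>2 - (t - t0) * x) * p x)"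
proof -
  define C where "C = (t - t0)\<^sup>2 / (a\<^sup>2 - \<bar>t - t0\<bar> * a)"
  \<comment> \<open>Integrability over the interval gives measurability of the cut-off of
    \<open>p\<close>, so the bound is applied to that function.\<close>
  define g where "g x = indicator {-a..a} x *\<^sub>R p x" for x
  have g: "integrable lborel g" using p unfolding set_integrable_def g_def .
  have [measurable]: "g \<in> borel_measurable borel" using g by (auto dest: borel_measurable_integrable)
  have "integrable lborel (\<lambda>x. (t - t0)\<^sup>2 / (a\<^sup>2 - (t - t0) * x) * g x)"
  proof (rule Bochner_Integration.integrable_bound)
    show "integrable lborel (\<lambda>x. C * g x)" using g by simp
    show "(\<lambda>x. (t - t0)\<^sup>2 / (a\<^sup>2 - (t - t0) * x) * g x) \<in> borel_measurable lborel" by measurable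
    have "norm ((t - t0)\<^sup>2 / (a\<^sup>2 - (t - t0) * x) * g x) \<le> norm (C * g x)" for x
    proof (cases "x \<in> {-a..a}")
      case True
      note d = denominator_pos[OF a True]
      have "\<bar>(t - t0)\<^sup>2 / (a\<^sup>2 - (t - t0) * x)\<bar> \<le> \<bar>C\<bar>"
        unfolding C_def using d by (auto intro!: divide_left_mono mult_pos_pos)
      then show ?thesis
        by (simp only: real_norm_def abs_mult) (rule mult_right_mono, assumption, simp)
    qed (simp add: g_def)
    then show "AE x in lborel. norm ((t - t0)\<^sup>2 / (a\<^sup>2 - (t - t0) * x) * g x) \<le> norm (C * g x)" by simp
  qed
  then show ?thesis unfolding set_integrable_def g_def by (simp add: algebra_simps)
qed

text \<open>An almost everywhere nonnegative integrand with zero integral vanishes almost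
  everywhere. Where \<open>p\<close> is positive this forces \<open>G = 0\<close>, so finitely many
  zeros would make the interval a null set. The sign of \<open>G\<close> at \<open>0\<close> may
  stay open since a point is a null set.\<close>

lemma infinite_zeros_of_weighted_integral:
  fixes G p :: "real \<Rightarrow> real"
  assumes int: "set_integrable lborel S (\<lambda>x. G x * p x)" and zero: "(LINT x:S|lborel. G x * p x) = 0"
    and p: "\<And>x. x \<in> S \<Longrightarrow> p x \<ge> 0" and G: "\<And>x. x \<in> S \<Longrightarrow> x \<noteq> 0 \<Longrightarrow> G x \<ge> 0"
    and lu: "l < u" "{l..u} \<subseteq> S" and pos: "AE x in lborel. x \<in> {l..u} \<longrightarrow> p x > 0"
  shows "infinite {x \<in> {l..u}. x \<noteq> 0 \<and> G x = 0}"
proof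
  let ?X = "{x \<in> {l..u}. x \<noteq> 0 \<and> G x = 0}"
  assume fin: "finite ?X"
  have ne0: "AE x in lborel. x \<noteq> (0 :: real)" by (rule AE_lborel_singleton)
  have nn: "AE x in lborel. 0 \<le> indicator S x *\<^sub>R (G x * p x)"
    using ne0 by eventually_elim (auto simp: indicator_def p G)
  have "AE x in lborel. indicator S x *\<^sub>R (G x * p x) = 0"
    using integral_nonneg_eq_0_iff_AE[OF int[unfolded set_integrable_def] nn] zero
    unfolding set_lebesgue_integral_def by simp
  moreover have "AE x in lborel. x \<notin> insert 0 ?X"
    using fin by (intro AE_not_in finite_imp_null_set_lborel) simp
  ultimately have "AE x in lborel. x \<notin> {l..u}"
    using pos by eventually_elim (use lu in \<open>auto simp: indicator_def split: if_splits\<close>)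
  then have "emeasure lborel {l..u} = 0"
    using AE_iff_null_sets[of "{l..u}" lborel] by auto
  then show False using lu by simp
qed

subsection \<open>Equality\<close>

text \<open>The integral of \<open>\<phi>\<close> against the discrete measure on the eigenvalue
  ratios. The value type is general so that real functions (entropies) and complex powers (traces)
  are treated alike.\<close>

definition ratio_sum ::
  "nat \<Rightarrow> complex mat \<Rightarrow> (nat \<Rightarrow> real) \<Rightarrow> complex mat \<Rightarrow> (nat \<Rightarrow> real) \<Rightarrow> (real \<Rightarrow> 'a :: real_vector) \<Rightarrow> 'a" where
  "ratio_sum n U p V q \<phi> =
     (\<Sum>i<n. \<Sum>j<n. (p i * (norm ((mat_adjoint V * U) $$ (j, i)))\<^sup>2) *\<^sub>R \<phi> (q j / p i))"

text \<open>Each summand rests on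
  \<open>p\<^sup>1\<^sup>-\<^sup>z * q\<^sup>z = p * (q / p)\<^sup>z\<close>, the powers being
  exponentials of logarithms of positive numbers.\<close>

lemma ratio_sum_trace_cpow:
  assumes \<rho>: "spectral_decomp \<rho> U p" "\<rho> \<in> carrier_mat n n" "\<And>i. i < n \<Longrightarrow> p i > 0"
    and \<sigma>: "spectral_decomp \<sigma> V q" "\<sigma> \<in> carrier_mat n n" "\<And>i. i < n \<Longrightarrow> q i > 0"
  shows "mat_trace (mat_cpow \<sigma> z * mat_cpow \<rho> (- z + 1)) =
    ratio_sum n U p V q (\<lambda>r. exp (z * complex_of_real (ln r)))"
  unfolding mat_cpow_conj_diag[OF \<rho>(1,2)] mat_cpow_conj_diag[OF \<sigma>(1,2)]
    trace_conj_diag_mult[OF spectral_decompD(1)[OF \<rho>(1,2)] spectral_decompD(1)[OF \<sigma>(1,2)]] ratio_sum_def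
proof (intro sum.cong refl)
  fix i j assume "i \<in> {..<n}" "j \<in> {..<n}"
  then have ij: "p i > 0" "q j > 0" using \<rho>(3) \<sigma>(3) by auto
  have p: "complex_of_real (p i) = exp (complex_of_real (ln (p i)))"
    using ij unfolding exp_of_real by simp
  have "exp ((- z + 1) * complex_of_real (ln (p i))) * exp (z * complex_of_real (ln (q j))) =
    complex_of_real (p i) * exp (z * complex_of_real (ln (q j / p i)))"
    unfolding p exp_add[symmetric] using ij by (simp add: ln_div algebra_simps)
  then show "exp ((- z + 1) * complex_of_real (ln (p i))) * exp (z * complex_of_real (ln (q j))) *
      complex_of_real ((norm ((mat_adjoint V * U) $$ (j, i)))\<^sup>2) =
    (p i * (norm ((mat_adjoint V * U) $$ (j, i)))\<^sup>2) *\<^sub>R exp (z * complex_of_real (ln (q j / p i)))"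
    by (simp add: scaleR_conv_of_real)
qed

text \<open>Inserting the identity, written in the eigenbasis of the other matrix, turns each trace
  into a double sum. The two values are the mass and the first moment of the ratio measure.\<close>

lemma ratio_sum_trace:
  assumes \<rho>: "spectral_decomp \<rho> U p" "\<rho> \<in> carrier_mat n n" "\<And>i. i < n \<Longrightarrow> p i > 0"
    and \<sigma>: "spectral_decomp \<sigma> V q" "\<sigma> \<in> carrier_mat n n"
  shows "ratio_sum n U p V q (\<lambda>_. 1) = Re (mat_trace \<rho>)"
    and "ratio_sum n U p V q (\<lambda>r. r) = Re (mat_trace \<sigma>)"
proof -
  note r = spectral_decompD[OF \<rho>(1,2)] and s = spectral_decompD[OF \<sigma>]
  have "mat_trace \<rho> = mat_trace ((V * mat_diag n (\<lambda>_. 1) * mat_adjoint V) *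
    (U * mat_diag n (\<lambda>i. complex_of_real (p i)) * mat_adjoint U))"
    unfolding conj_diag_one[OF s(1,2)] r(3)[symmetric] using \<rho>(2) by simp
  also have "\<dots> = complex_of_real (\<Sum>i<n. \<Sum>j<n. p i * 1 * (norm ((mat_adjoint V * U) $$ (j, i)))\<^sup>2)"
    unfolding trace_conj_diag_mult[OF r(1) s(1)] by simp
  finally show "ratio_sum n U p V q (\<lambda>_. 1) = Re (mat_trace \<rho>)"
    unfolding ratio_sum_def by (simp only: Re_complex_of_real) simp
  have "mat_trace \<sigma> = mat_trace ((V * mat_diag n (\<lambda>i. complex_of_real (q i)) * mat_adjoint V) *
    (U * mat_diag n (\<lambda>_. 1) * mat_adjoint U))"
    unfolding conj_diag_one[OF r(1,2)] s(3)[symmetric] using \<sigma>(2) by simp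
  also have "\<dots> = complex_of_real (\<Sum>i<n. \<Sum>j<n. 1 * q j * (norm ((mat_adjoint V * U) $$ (j, i)))\<^sup>2)"
    unfolding trace_conj_diag_mult[OF r(1) s(1)] by simp
  also have "(\<Sum>i<n. \<Sum>j<n. 1 * q j * (norm ((mat_adjoint V * U) $$ (j, i)))\<^sup>2) =
    ratio_sum n U p V q (\<lambda>r. r)"
    unfolding ratio_sum_def using \<rho>(3) by (intro sum.cong refl) force
  finally show "ratio_sum n U p V q (\<lambda>r. r) = Re (mat_trace \<sigma>)" by simp
qed

lemma ratio_sum_resolvent:
  assumes p: "\<And>i. i < n \<Longrightarrow> p i > 0"
  shows "ratio_sum n U p V q (\<lambda>r. 1 / (c1 + c2 * r)) = resolvent_sum c1 c2 n U p V q"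
  unfolding ratio_sum_def resolvent_sum_def
proof (intro sum.cong refl)
  fix i j assume "i \<in> {..<n}"
  then have pi: "p i > 0" using p by simp
  have "c1 + c2 * (q j / p i) = (c1 * p i + c2 * q j) / p i" using pi by (simp add: field_simps)
  then show "(p i * (norm ((mat_adjoint V * U) $$ (j, i)))\<^sup>2) *\<^sub>R (1 / (c1 + c2 * (q j / p i))) =
    (p i)\<^sup>2 * (norm ((mat_adjoint V * U) $$ (j, i)))\<^sup>2 / (c1 * p i + c2 * q j)"
    by (simp add: power2_eq_square)
qed

text \<open>An optimal \<open>Y\<close> for the reduced matrices yields the competitor
  \<open>kron Y (1\<^sub>m dB)\<close> on the composite system, with the same value of the
  functional.\<close>

lemma resolvent_monotone:
  assumes AB: "spectral_decomp \<rho> U p" "\<rho> \<in> carrier_mat (dA * dB) (dA * dB)" "\<And>i. i < dA * dB \<Longrightarrow> p i > 0"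
    "spectral_decomp \<sigma> V q" "\<sigma> \<in> carrier_mat (dA * dB) (dA * dB)"
    and A: "spectral_decomp (partial_trace_B dA dB \<rho>) U' p'" "\<And>i. i < dA \<Longrightarrow> p' i > 0"
    "spectral_decomp (partial_trace_B dA dB \<sigma>) V' q'"
    and pos: "\<And>i j. i < dA * dB \<Longrightarrow> j < dA * dB \<Longrightarrow> c1 + c2 * (q j / p i) > 0"
    "\<And>i j. i < dA \<Longrightarrow> j < dA \<Longrightarrow> c1 + c2 * (q' j / p' i) > 0"
  shows "ratio_sum dA U' p' V' q' (\<lambda>r. 1 / (c1 + c2 * r)) \<le> ratio_sum (dA * dB) U p V q (\<lambda>r. 1 / (c1 + c2 * r))"
proof -
  have scale: "c1 * x + c2 * y > 0" if "c1 + c2 * (y / x) > 0" "x > 0" for x y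
  proof -
    have "c1 * x + c2 * y = (c1 + c2 * (y / x)) * x" using that by (simp add: field_simps)
    then show ?thesis using that by simp
  qed
  note T = partial_trace_carrier[of dA dB]
  obtain Y where Y: "Y \<in> carrier_mat dA dA"
    "resolvent_form c1 c2 (partial_trace_B dA dB \<rho>) (partial_trace_B dA dB \<sigma>) Y = resolvent_sum c1 c2 dA U' p' V' q'"
    using resolvent_form_attained[OF A(1) T A(3) T scale[OF pos(2) A(2)]] by metis
  have K: "kron Y (1\<^sub>m dB) \<in> carrier_mat (dA * dB) (dA * dB)" using kron_carrier[OF Y(1)] by auto
  have "ratio_sum dA U' p' V' q' (\<lambda>r. 1 / (c1 + c2 * r)) = resolvent_form c1 c2 \<rho> \<sigma> (kron Y (1\<^sub>m dB))"
    unfolding resolvent_form_partial_trace[OF Y(1) AB(2,5)] Y(2) by (rule ratio_sum_resolvent[OF A(2)])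
  also have "\<dots> \<le> resolvent_sum c1 c2 (dA * dB) U p V q"
    by (rule resolvent_form_le[OF AB(1,2,4,5) K AB(3) scale[OF pos(1) AB(3)]])
  also have "\<dots> = ratio_sum (dA * dB) U p V q (\<lambda>r. 1 / (c1 + c2 * r))"
    by (rule ratio_sum_resolvent[OF AB(3), symmetric])
  finally show ?thesis .
qed

text \<open>The signed measure \<open>m\<close> with its atoms merged. The same weights serve real
  and complex test functions; the formula is stated at both types because a premise cannot be
  polymorphic.\<close>

lemma ratio_sum_diff_weights:
  obtains T m where "finite T"
    "T \<subseteq> {q j / p i | i j. i < n \<and> j < n} \<union> {q' j / p' i | i j. i < n' \<and> j < n'}"
    "\<And>\<phi> :: real \<Rightarrow> real. ratio_sum n U p V q \<phi> - ratio_sum n' U' p' V' q' \<phi> = (\<Sum>t\<in>T. m t * \<phi> t)"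
    "\<And>\<phi> :: real \<Rightarrow> complex. ratio_sum n U p V q \<phi> - ratio_sum n' U' p' V' q' \<phi> = (\<Sum>t\<in>T. m t *\<^sub>R \<phi> t)"
proof -
  \<comment> \<open>A disjoint union keeps the two families apart although their index pairs
    overlap; the second one gets negative weights.\<close>
  define K where "K = ({..<n} \<times> {..<n}) <+> ({..<n'} \<times> {..<n'})"
  define w where "w = case_sum (\<lambda>(i, j). p i * (norm ((mat_adjoint V * U) $$ (j, i)))\<^sup>2)
    (\<lambda>(i, j). - (p' i * (norm ((mat_adjoint V' * U') $$ (j, i)))\<^sup>2))"
  define r where "r = case_sum (\<lambda>(i, j). q j / p i) (\<lambda>(i, j). q' j / p' i)"
  have K: "finite K" unfolding K_def by auto
  define m where "m t = (\<Sum>k | k \<in> K \<and> r k = t. w k)" for t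
  have *: "ratio_sum n U p V q \<phi> - ratio_sum n' U' p' V' q' \<phi> = (\<Sum>k\<in>K. w k *\<^sub>R \<phi> (r k))"
    for \<phi> :: "real \<Rightarrow> 'b :: real_vector"
    unfolding ratio_sum_def K_def w_def r_def sum.cartesian_product
    by (subst sum.Plus) (auto simp: case_prod_unfold sum_negf)
  show ?thesis
  proof
    show "finite (r ` K)" using K by simp
    show "r ` K \<subseteq> {q j / p i | i j. i < n \<and> j < n} \<union> {q' j / p' i | i j. i < n' \<and> j < n'}"
      unfolding K_def r_def by auto
    show "ratio_sum n U p V q \<phi> - ratio_sum n' U' p' V' q' \<phi> = (\<Sum>t\<in>r ` K. m t * \<phi> t)"
      for \<phi> :: "real \<Rightarrow> real"
      unfolding * sum_scaleR_image_gen[OF K] m_def by simp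
    show "ratio_sum n U p V q \<phi> - ratio_sum n' U' p' V' q' \<phi> = (\<Sum>t\<in>r ` K. m t *\<^sub>R \<phi> t)"
      for \<phi> :: "real \<Rightarrow> complex"
      unfolding * sum_scaleR_image_gen[OF K] m_def ..
  qed
qed

section \<open>From equal entropies to vanishing weights\<close>

text \<open>With \<open>D = a\<^sup>2 - (t - t0) * x\<close> one has
  \<open>(t - t0) * x = a\<^sup>2 - D\<close>, whose square is \<open>a ^ 4\<close> minus
  \<open>D\<close> times a factor affine in \<open>t\<close>. Division by \<open>D\<close> leaves a
  resolvent and affine terms.\<close>

lemma kernel_resolvent:
  fixes a t t0 x :: real
  assumes "x \<noteq> 0" "a\<^sup>2 - (t - t0) * x \<noteq> 0"
  shows "(t - t0)\<^sup>2 / (a\<^sup>2 - (t - t0) * x) =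
    a ^ 4 / x\<^sup>2 * (1 / (a\<^sup>2 + t0 * x + (- x) * t)) - (a\<^sup>2 - t0 * x) / x\<^sup>2 - 1 / x * t"
proof -
  have d: "a\<^sup>2 + t0 * x + (- x) * t = a\<^sup>2 - (t - t0) * x" by (simp add: algebra_simps)
  define D where "D = a\<^sup>2 - (t - t0) * x"
  have D: "D \<noteq> 0" using assms unfolding D_def by simp
  have "(t - t0)\<^sup>2 * x\<^sup>2 = a ^ 4 - (a\<^sup>2 - t0 * x + x * t) * D"
    unfolding D_def by (simp add: power2_eq_square power4_eq_xxxx algebra_simps)
  then have "(t - t0)\<^sup>2 = (a ^ 4 - (a\<^sup>2 - t0 * x + x * t) * D) / x\<^sup>2"
    using assms by (simp add: field_simps)
  then have "(t - t0)\<^sup>2 / D = a ^ 4 / x\<^sup>2 * (1 / D) - (a\<^sup>2 - t0 * x + x * t) / x\<^sup>2"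
    using D by (simp add: diff_divide_distrib)
  also have "(a\<^sup>2 - t0 * x + x * t) / x\<^sup>2 = (a\<^sup>2 - t0 * x) / x\<^sup>2 + 1 / x * t"
    using assms by (simp add: add_divide_distrib power2_eq_square)
  finally show ?thesis unfolding d D_def[symmetric] by simp
qed

text \<open>Zero mass and zero mean leave only the integral part of \<open>f\<close>, and the
  resolvent premise gives its integrand a sign pointwise in \<open>x\<close>. The infinitely many
  zeros of \<open>G\<close> then feed the partial fraction argument.\<close>

lemma diffused_zero_imp_weights_zero:
  assumes f: "diffused t0 a f" and T: "finite T" "T \<subseteq> {t0 - a<..<t0 + a}"
    and one: "(\<Sum>t\<in>T. m t) = 0" and id: "(\<Sum>t\<in>T. m t * t) = 0" and fz: "(\<Sum>t\<in>T. m t * f t) = 0"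
    and res: "\<And>c1 c2. (\<And>t. t \<in> {t0 - a<..<t0 + a} \<Longrightarrow> c1 + c2 * t > 0) \<Longrightarrow> (\<Sum>t\<in>T. m t * (1 / (c1 + c2 * t))) \<ge> 0"
    and t: "t \<in> T"
  shows "m t = 0"
proof -
  have a: "a > 0" using f unfolding diffused_def by blast
  obtain b c \<kappa> p l u where \<kappa>: "\<kappa> > 0" and p: "pdf_on {-a..a} p"
    and lu: "-a \<le> l" "l < u" "u \<le> a" "AE x in lborel. x \<in> {l..u} \<longrightarrow> p x > 0"
    and rep: "\<And>t. t \<in> {t0 - a<..<t0 + a} \<Longrightarrow> f t = b + c * t +
             \<kappa> * (LINT x:{-a..a}|lborel. (t - t0)\<^sup>2 / (a\<^sup>2 - (t - t0) * x) * p x)"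
    using f unfolding diffused_def by blast
  have pint: "set_integrable lborel {-a..a} p" and pnn: "\<And>x. x \<in> {-a..a} \<Longrightarrow> p x \<ge> 0"
    using p unfolding pdf_on_def by auto
  define G where "G x = (\<Sum>t\<in>T. m t * ((t - t0)\<^sup>2 / (a\<^sup>2 - (t - t0) * x)))" for x
  have Gp: "G x * p x = (\<Sum>t\<in>T. m t * ((t - t0)\<^sup>2 / (a\<^sup>2 - (t - t0) * x) * p x))" for x
    unfolding G_def by (simp add: sum_distrib_right mult.assoc)
  have int: "set_integrable lborel {-a..a} (\<lambda>x. m t * ((t - t0)\<^sup>2 / (a\<^sup>2 - (t - t0) * x) * p x))" if "t \<in> T" for t
    using that T by (intro set_integrable_mult_right kernel_set_integrable[OF a _ pint]) auto
  have Gint: "set_integrable lborel {-a..a} (\<lambda>x. G x * p x)"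
    unfolding Gp set_integrable_def scaleR_sum_right
    by (intro Bochner_Integration.integrable_sum int[unfolded set_integrable_def])
  have GL: "(LINT x:{-a..a}|lborel. G x * p x) =
    (\<Sum>t\<in>T. m t * (LINT x:{-a..a}|lborel. (t - t0)\<^sup>2 / (a\<^sup>2 - (t - t0) * x) * p x))"
  proof -
    have "(LINT x:{-a..a}|lborel. G x * p x) =
      (\<Sum>t\<in>T. LINT x:{-a..a}|lborel. m t * ((t - t0)\<^sup>2 / (a\<^sup>2 - (t - t0) * x) * p x))"
      unfolding Gp set_lebesgue_integral_def scaleR_sum_right
      by (intro Bochner_Integration.integral_sum int[unfolded set_integrable_def])
    then show ?thesis by (simp only: set_integral_mult_right)
  qed
  have "\<kappa> * (LINT x:{-a..a}|lborel. G x * p x) =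
    (\<Sum>t\<in>T. m t * f t) - b * (\<Sum>t\<in>T. m t) - c * (\<Sum>t\<in>T. m t * t)"
    unfolding GL sum_distrib_left sum_subtractf[symmetric]
    using T(2) by (intro sum.cong refl) (auto simp: rep algebra_simps)
  also have "\<dots> = 0" by (simp add: one id fz)
  finally have zero: "(LINT x:{-a..a}|lborel. G x * p x) = 0" using \<kappa> by simp
  have Gnn: "G x \<ge> 0" if x: "x \<in> {-a..a}" "x \<noteq> 0" for x
  proof -
    define c1 where "c1 = a\<^sup>2 + t0 * x"
    have c1: "c1 + (- x) * t = a\<^sup>2 - (t - t0) * x" for t unfolding c1_def by (simp add: algebra_simps)
    have pos: "c1 + (- x) * t > 0" if "t \<in> {t0 - a<..<t0 + a}" for t
      unfolding c1 using denominator_pos[OF a that x(1)] by linarith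
    have "G x = (\<Sum>t\<in>T. m t * (a ^ 4 / x\<^sup>2 * (1 / (c1 + (- x) * t)) - (a\<^sup>2 - t0 * x) / x\<^sup>2 - 1 / x * t))"
      unfolding G_def
    proof (intro sum.cong refl)
      fix t assume "t \<in> T"
      then have nz: "a\<^sup>2 - (t - t0) * x \<noteq> 0" using pos T unfolding c1 by force
      show "m t * ((t - t0)\<^sup>2 / (a\<^sup>2 - (t - t0) * x)) =
        m t * (a ^ 4 / x\<^sup>2 * (1 / (c1 + (- x) * t)) - (a\<^sup>2 - t0 * x) / x\<^sup>2 - 1 / x * t)"
        unfolding c1_def kernel_resolvent[OF x(2) nz] ..
    qed
    also have "\<dots> = a ^ 4 / x\<^sup>2 * (\<Sum>t\<in>T. m t * (1 / (c1 + (- x) * t))) -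
      (a\<^sup>2 - t0 * x) / x\<^sup>2 * (\<Sum>t\<in>T. m t) - 1 / x * (\<Sum>t\<in>T. m t * t)"
      unfolding sum_distrib_left sum_subtractf[symmetric]
      by (intro sum.cong refl) (simp add: algebra_simps)
    \<comment> \<open>The affine terms integrate to zero, and the coefficient
      \<open>a ^ 4 / x\<^sup>2\<close> of the resolvent is nonnegative.\<close>
    also have "\<dots> \<ge> 0" using res[of c1 "- x", OF pos] by (simp only: one id) simp
    finally show ?thesis .
  qed
  have sub: "{l..u} \<subseteq> {-a..a}" using lu by auto
  have inf: "infinite {x \<in> {l..u}. x \<noteq> 0 \<and> G x = 0}"
    using infinite_zeros_of_weighted_integral[OF Gint zero pnn Gnn lu(2) sub lu(4)] by blast
  have "a\<^sup>2 - (s - t0) * x \<noteq> 0" if "x \<in> {x \<in> {l..u}. x \<noteq> 0 \<and> G x = 0}" "s \<in> T" for x s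
    using denominator_pos[OF a, of s t0 x] that T sub by force
  then have away: "m s = 0" if "s \<in> T" "s \<noteq> t0" for s
    using partial_fractions_zero_imp_zero[OF T(1) inf, of a t0 m s] a that unfolding G_def by blast
  show ?thesis
  \<comment> \<open>At \<open>t0\<close> the kernel vanishes for every \<open>x\<close>, so the
    weight there has to be recovered from the total mass.\<close>
  proof (cases "t = t0")
    case True
    then have "(\<Sum>s\<in>T - {t}. m s) = 0" using away by (intro sum.neutral) auto
    then show ?thesis using one T t by (simp add: sum.remove)
  qed (use away t in blast)
qed

theorem lemma3:
  fixes f :: "real \<Rightarrow> real" and t0 a \<alpha> :: real
    and dA dB :: nat
    and \<rho>AB \<sigma>AB \<rho>A \<sigma>A :: "complex mat"
  assumes f: "diffused t0 a f"
    and dom: "{t0 - a<..<t0 + a} \<subseteq> {0<..<\<alpha>}"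
    and dims: "0 < dA" "0 < dB"
    and pos: "strictly_positive_mat (dA * dB) \<rho>AB" "strictly_positive_mat (dA * dB) \<sigma>AB"
    and red: "\<rho>A = partial_trace_B dA dB \<rho>AB" "\<sigma>A = partial_trace_B dA dB \<sigma>AB"
    and ratios: "eigenvalue_ratios_in \<rho>AB \<sigma>AB {t0 - a<..<t0 + a}"
                "eigenvalue_ratios_in \<rho>A \<sigma>A {t0 - a<..<t0 + a}"
  shows "quantum_f_relent f \<rho>AB \<sigma>AB = quantum_f_relent f \<rho>A \<sigma>A \<longleftrightarrow>
    (\<forall>t :: complex.
       mat_trace (mat_cpow \<sigma>AB (\<i> * t) * mat_cpow \<rho>AB (- \<i> * t + 1)) =
       mat_trace (mat_cpow \<sigma>A (\<i> * t) * mat_cpow \<rho>A (- \<i> * t + 1)))"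
proof -
  let ?N = "dA * dB"
  have posA: "strictly_positive_mat dA \<rho>A" "strictly_positive_mat dA \<sigma>A"
    unfolding red by (rule strictly_positive_partial_trace[OF pos(1) dims(2)],
        rule strictly_positive_partial_trace[OF pos(2) dims(2)])
  have c: "\<rho>AB \<in> carrier_mat ?N ?N" "\<sigma>AB \<in> carrier_mat ?N ?N" "\<rho>A \<in> carrier_mat dA dA" "\<sigma>A \<in> carrier_mat dA dA"
    using pos posA by (auto simp: strictly_positive_mat_def hermitian_mat_def)
  obtain U p where \<rho>: "spectral_decomp \<rho>AB U p" "\<And>i. i < ?N \<Longrightarrow> p i > 0"
    using strictly_positive_decomp[OF pos(1)] by metis
  obtain V q where \<sigma>: "spectral_decomp \<sigma>AB V q" "\<And>i. i < ?N \<Longrightarrow> q i > 0"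
    using strictly_positive_decomp[OF pos(2)] by metis
  obtain U' p' where \<rho>': "spectral_decomp \<rho>A U' p'" "\<And>i. i < dA \<Longrightarrow> p' i > 0"
    using strictly_positive_decomp[OF posA(1)] by metis
  obtain V' q' where \<sigma>': "spectral_decomp \<sigma>A V' q'" "\<And>i. i < dA \<Longrightarrow> q' i > 0"
    using strictly_positive_decomp[OF posA(2)] by metis
  have rAB: "q j / p i \<in> {t0 - a<..<t0 + a}" if "i < ?N" "j < ?N" for i j
    using ratios(1) spectral_eigenvalue[OF \<rho>(1) c(1) that(1)] spectral_eigenvalue[OF \<sigma>(1) c(2) that(2)]
    unfolding eigenvalue_ratios_in_def by blast
  have rA: "q' j / p' i \<in> {t0 - a<..<t0 + a}" if "i < dA" "j < dA" for i j
    using ratios(2) spectral_eigenvalue[OF \<rho>'(1) c(3) that(1)] spectral_eigenvalue[OF \<sigma>'(1) c(4) that(2)]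
    unfolding eigenvalue_ratios_in_def by blast
  obtain T m where T0: "finite T"
    "T \<subseteq> {q j / p i | i j. i < ?N \<and> j < ?N} \<union> {q' j / p' i | i j. i < dA \<and> j < dA}"
    and mr: "\<And>\<phi> :: real \<Rightarrow> real. ratio_sum ?N U p V q \<phi> - ratio_sum dA U' p' V' q' \<phi> = (\<Sum>t\<in>T. m t * \<phi> t)"
    and mc: "\<And>\<phi> :: real \<Rightarrow> complex. ratio_sum ?N U p V q \<phi> - ratio_sum dA U' p' V' q' \<phi> = (\<Sum>t\<in>T. m t *\<^sub>R \<phi> t)"
    by (rule ratio_sum_diff_weights[where n = ?N and U = U and p = p and V = V and q = q and
          n' = dA and U' = U' and p' = p' and V' = V' and q' = q']) (rule that)
  have T: "T \<subseteq> {t0 - a<..<t0 + a}" using T0(2) rAB rA by auto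
  \<comment> \<open>Positive atoms allow \<open>exp (n * ln s)\<close> to be read as
    \<open>s ^ n\<close> in the moment argument.\<close>
  have Tpos: "t > 0" if "t \<in> T" for t using that T dom by auto
  have relent: "quantum_f_relent f \<rho>AB \<sigma>AB = ratio_sum ?N U p V q f"
    "quantum_f_relent f \<rho>A \<sigma>A = ratio_sum dA U' p' V' q' f"
    unfolding ratio_sum_def real_scaleR_def
    by (rule quantum_f_relent_sum[OF \<rho>(1) c(1) \<rho>(2) \<sigma>(1) c(2)], assumption,
        rule quantum_f_relent_sum[OF \<rho>'(1) c(3) \<rho>'(2) \<sigma>'(1) c(4)], assumption)
  have "quantum_f_relent f \<rho>AB \<sigma>AB - quantum_f_relent f \<rho>A \<sigma>A = (\<Sum>t\<in>T. m t * f t)"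
    unfolding relent by (rule mr)
  then have L: "quantum_f_relent f \<rho>AB \<sigma>AB = quantum_f_relent f \<rho>A \<sigma>A \<longleftrightarrow> (\<Sum>t\<in>T. m t * f t) = 0"
    by auto
  have cpow: "mat_trace (mat_cpow \<sigma>AB z * mat_cpow \<rho>AB (- z + 1)) -
    mat_trace (mat_cpow \<sigma>A z * mat_cpow \<rho>A (- z + 1)) = (\<Sum>t\<in>T. m t *\<^sub>R exp (z * complex_of_real (ln t)))" for z
  proof -
    have "mat_trace (mat_cpow \<sigma>AB z * mat_cpow \<rho>AB (- z + 1)) =
      ratio_sum ?N U p V q (\<lambda>r. exp (z * complex_of_real (ln r)))"
      by (rule ratio_sum_trace_cpow[OF \<rho>(1) c(1) \<rho>(2) \<sigma>(1) c(2) \<sigma>(2)])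
    moreover have "mat_trace (mat_cpow \<sigma>A z * mat_cpow \<rho>A (- z + 1)) =
      ratio_sum dA U' p' V' q' (\<lambda>r. exp (z * complex_of_real (ln r)))"
      by (rule ratio_sum_trace_cpow[OF \<rho>'(1) c(3) \<rho>'(2) \<sigma>'(1) c(4) \<sigma>'(2)])
    ultimately show ?thesis by (simp only: mc)
  qed
  have R: "mat_trace (mat_cpow \<sigma>AB (\<i> * t) * mat_cpow \<rho>AB (- \<i> * t + 1)) =
       mat_trace (mat_cpow \<sigma>A (\<i> * t) * mat_cpow \<rho>A (- \<i> * t + 1)) \<longleftrightarrow>
    (\<Sum>s\<in>T. m s *\<^sub>R exp (\<i> * t * complex_of_real (ln s))) = 0" for t
    using cpow[of "\<i> * t"] by (auto simp: algebra_simps)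
  show ?thesis
    unfolding L R
  proof (intro iffI allI)
    fix t assume fz: "(\<Sum>t\<in>T. m t * f t) = 0"
    have one: "(\<Sum>t\<in>T. m t) = 0" and id: "(\<Sum>t\<in>T. m t * t) = 0"
      using mr[of "\<lambda>_. 1"] mr[of "\<lambda>r. r"]
        ratio_sum_trace[OF \<rho>(1) c(1) \<rho>(2) \<sigma>(1) c(2)] ratio_sum_trace[OF \<rho>'(1) c(3) \<rho>'(2) \<sigma>'(1) c(4)]
        trace_partial_trace[OF c(1)] trace_partial_trace[OF c(2)] unfolding red by auto
    \<comment> \<open>Positivity on the whole domain covers the eigenvalue ratios of both systems,
      as the comparison of resolvents requires.\<close>
    have "(\<Sum>t\<in>T. m t * (1 / (c1 + c2 * t))) \<ge> 0"
      if "\<And>t. t \<in> {t0 - a<..<t0 + a} \<Longrightarrow> c1 + c2 * t > 0" for c1 c2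
      using resolvent_monotone[OF \<rho>(1) c(1) \<rho>(2) \<sigma>(1) c(2) \<rho>'(1)[unfolded red] \<rho>'(2) \<sigma>'(1)[unfolded red]
          that[OF rAB] that[OF rA]] mr[of "\<lambda>r. 1 / (c1 + c2 * r)"] by simp
    then have "m s = 0" if "s \<in> T" for s
      using diffused_zero_imp_weights_zero[OF f T0(1) T one id fz _ that] by blast
    then show "(\<Sum>s\<in>T. m s *\<^sub>R exp (\<i> * t * complex_of_real (ln s))) = 0" by simp
  next
    assume ex: "\<forall>t. (\<Sum>s\<in>T. m s *\<^sub>R exp (\<i> * t * complex_of_real (ln s))) = 0"
    have "(\<Sum>s\<in>T. m s * s ^ n) = 0" for n
    proof -
      \<comment> \<open>The choice \<open>t = - \<i> * n\<close> makes \<open>\<i> * t\<close> equal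
        to \<open>n\<close>; it is available because \<open>t\<close> ranges over all complex
        numbers.\<close>
      have e: "exp (\<i> * (- \<i> * of_nat n) * complex_of_real (ln s)) = complex_of_real (s ^ n)" if "s \<in> T" for s
      proof -
        have "\<i> * (- \<i> * of_nat n) * complex_of_real (ln s) = of_nat n * complex_of_real (ln s)" by simp
        then show ?thesis
          using Tpos[OF that] by (simp only: exp_of_nat_mult exp_of_real) simp
      qed
      have "complex_of_real (\<Sum>s\<in>T. m s * s ^ n) = (\<Sum>s\<in>T. m s *\<^sub>R exp (\<i> * (- \<i> * of_nat n) * complex_of_real (ln s)))"
        unfolding of_real_sum by (intro sum.cong refl) (simp only: e scaleR_conv_of_real of_real_mult)
      also have "\<dots> = 0" using ex by blast
      finally show ?thesis by (simp only: of_real_eq_0_iff)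
    qed
    then have "m s = 0" if "s \<in> T" for s using moments_zero_imp_zero[OF T0(1)] that by blast
    then show "(\<Sum>t\<in>T. m t * f t) = 0" by simp
  qed
qed

end
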